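(* For every $0<\varepsilon<1$ and every $C>0$ there exists $n_0$ such that the following holds for all $n\ge n_0$. Let $G$ be a multipartite graph with parts $V_1,\ldots,V_k$, each of size $|V_i|\ge n$, such that the maximum degree of $G$ is at most $(1-\varepsilon)n$ and the local degree of $G$ is at most $C$. Then $G$ contains at least $(1-\varepsilon)n$ pairwise disjoint independent transversals.
   Context: A multipartite graph with parts $V_1,\ldots,V_k$ is a graph whose vertex set is the disjoint union $V_1\cup\cdots\cup V_k$ and which has no edge inside any part. An independent transversal is an independent set containing exactly one vertex from each part $V_i$. The local degree of $G$ is the maximum, over all vertices $v$ and all parts $V_i$, of the number of neighbours of $v$ in $V_i$. Quantities such as $(1-\varepsilon)n$ are understood up to rounding. *)

theory Defs
  imports Complex_Main "HOL-Library.Disjoint_Sets"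
begin

text \<open>
  A finite simple graph is given by its parts \<open>V 1, \<dots>, V k\<close>, whose union is the vertex
  set, and its adjacency relation \<open>E\<close>. Irreflexivity of \<open>E\<close> on the vertices is the absence of
  edges inside a part.
\<close>

definition part_union :: "nat \<Rightarrow> (nat \<Rightarrow> 'a set) \<Rightarrow> 'a set" where
  "part_union k V = (\<Union>i\<in>{1..k}. V i)"

definition multipartite_graph :: "nat \<Rightarrow> (nat \<Rightarrow> 'a set) \<Rightarrow> ('a \<Rightarrow> 'a \<Rightarrow> bool) \<Rightarrow> bool" where
  "multipartite_graph k V E \<longleftrightarrow>
     (\<forall>i\<in>{1..k}. finite (V i)) \<and>
     disjoint_family_on V {1..k} \<and>
     (\<forall>u v. E u v \<longrightarrow> u \<in> part_union k V \<and> v \<in> part_union k V) \<and>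
     (\<forall>u v. E u v \<longrightarrow> E v u) \<and>
     (\<forall>i\<in>{1..k}. \<forall>u\<in>V i. \<forall>v\<in>V i. \<not> E u v)"

definition neighbours :: "('a \<Rightarrow> 'a \<Rightarrow> bool) \<Rightarrow> 'a \<Rightarrow> 'a set" where
  "neighbours E v = {u. E v u}"

text \<open>The two maxima below are meaningful only if there is at least one vertex.\<close>

definition max_degree :: "nat \<Rightarrow> (nat \<Rightarrow> 'a set) \<Rightarrow> ('a \<Rightarrow> 'a \<Rightarrow> bool) \<Rightarrow> nat" where
  "max_degree k V E = Max ((\<lambda>v. card (neighbours E v)) ` part_union k V)"

definition local_degree :: "nat \<Rightarrow> (nat \<Rightarrow> 'a set) \<Rightarrow> ('a \<Rightarrow> 'a \<Rightarrow> bool) \<Rightarrow> nat" where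
  "local_degree k V E =
     Max ((\<lambda>(v, i). card (neighbours E v \<inter> V i)) ` (part_union k V \<times> {1..k}))"

definition independent_set :: "('a \<Rightarrow> 'a \<Rightarrow> bool) \<Rightarrow> 'a set \<Rightarrow> bool" where
  "independent_set E S \<longleftrightarrow> (\<forall>u\<in>S. \<forall>v\<in>S. \<not> E u v)"

definition independent_transversal ::
    "nat \<Rightarrow> (nat \<Rightarrow> 'a set) \<Rightarrow> ('a \<Rightarrow> 'a \<Rightarrow> bool) \<Rightarrow> 'a set \<Rightarrow> bool" where
  "independent_transversal k V E T \<longleftrightarrow>
     T \<subseteq> part_union k V \<and> independent_set E T \<and> (\<forall>i\<in>{1..k}. card (T \<inter> V i) = 1)"

end

theory Submission
  imports Defs "HOL-Library.FuncSet" "HOL-Real_Asymp.Real_Asymp"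
begin

text \<open>
  Cut the parts down to size \<open>n\<close> and put \<open>m = \<lceil>(1 - \<epsilon>) n\<rceil>\<close>. The task is to choose, for every part
  \<open>i\<close> and colour \<open>c < m\<close>, a vertex of part \<open>i\<close> such that the choices for different colours differ
  and the choices for one colour form an independent set. This is done by a semi-random
  procedure. In each round every uncoloured pair \<open>(i, c)\<close> is activated with a small probability
  \<open>\<theta>\<close> and then picks a uniformly random vertex of its list \<open>L i c\<close> of still available vertices; a pick
  is kept unless an earlier pick conflicts with it. Let \<open>a\<close> be a lower bound for the list sizes
  and let \<open>e = r a\<close> bound both the number of uncoloured \<open>c\<close> with \<open>v \<in> L i c\<close> (for each vertex \<open>v\<close>
  of part \<open>i\<close>) and the number of unused neighbours of \<open>v\<close> whose part is uncoloured in \<open>c\<close> (for each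
  \<open>v\<close> and \<open>c\<close>). Auxiliary coin flips make every vertex, and every pair of a vertex and a colour,
  disappear with the same probability about \<open>\<theta> r\<close>. Thus \<open>a\<close> is multiplied by about \<open>1 - 2 \<theta> r\<close> and
  \<open>e\<close> by about \<open>(1 - \<theta>) (1 - \<theta> r)\<close>, so that \<open>r\<close>, which is less than 1 at the start, decreases
  geometrically. All relevant quantities are dominated by sums to which exponential moment bounds
  apply, because the local degree is bounded; the failure probabilities are exponentially small in
  \<open>n\<close>, while each failure depends on polynomially many others, so the Lovasz Local Lemma provides
  a good outcome for any number of parts. After boundedly many rounds \<open>r \<le> 1/32\<close>, and one direct
  application of the Local Lemma colours the remaining pairs.
\<close>

subsection \<open>Finite product probability spaces\<close>

text \<open>All functions are compared, not only those of the product space, so that overwriting a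
  coordinate, as in \<open>depends_upd\<close>, needs no side condition.\<close>

definition depends :: "(('i \<Rightarrow> 'v) \<Rightarrow> 'b) \<Rightarrow> 'i set \<Rightarrow> bool" where
  "depends F A \<longleftrightarrow> (\<forall>f g. (\<forall>i\<in>A. f i = g i) \<longrightarrow> F f = F g)"

lemma dependsI: "(\<And>f g. (\<And>i. i \<in> A \<Longrightarrow> f i = g i) \<Longrightarrow> F f = F g) \<Longrightarrow> depends F A"
  unfolding depends_def by blast

lemma dependsD: "depends F A \<Longrightarrow> (\<And>i. i \<in> A \<Longrightarrow> f i = g i) \<Longrightarrow> F f = F g"
  unfolding depends_def by blast

lemma depends_compose: "depends F A \<Longrightarrow> depends (\<lambda>f. h (F f)) A"
  unfolding depends_def by metis

lemma depends_upd: "depends F A \<Longrightarrow> t \<notin> A \<Longrightarrow> F (f(t := x)) = F f"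
  by (rule dependsD) auto

lemma depends_prod:
  assumes "\<And>g. g \<in> G \<Longrightarrow> depends (F g) (A g)"
  shows "depends (\<lambda>f. \<Prod>g\<in>G. F g f) (\<Union>g\<in>G. A g)"
  by (rule dependsI, rule prod.cong) (auto intro!: dependsD[OF assms])

locale fin_prod =
  fixes I :: "'i set" and X :: "'v set" and w :: "'i \<Rightarrow> 'v \<Rightarrow> real"
  assumes finite_I: "finite I" and finite_X: "finite X"
    and w_nonneg: "\<And>i x. i \<in> I \<Longrightarrow> x \<in> X \<Longrightarrow> 0 \<le> w i x"
    and w_sum: "\<And>i. i \<in> I \<Longrightarrow> (\<Sum>x\<in>X. w i x) = 1"
begin

text \<open>All coordinates share the value set \<open>X\<close>; a range specific to one coordinate
  is encoded by giving the other values weight 0. Facts about such ranges hold on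
  \<open>supp\<close> only, and by \<open>Ex_mono\<close> that is enough.\<close>

definition supp :: "('i \<Rightarrow> 'v) set" where
  "supp = {f \<in> PiE I (\<lambda>_. X). \<forall>i\<in>I. w i (f i) > 0}"

definition Ex :: "(('i \<Rightarrow> 'v) \<Rightarrow> real) \<Rightarrow> real" where
  "Ex F = (\<Sum>f\<in>PiE I (\<lambda>_. X). (\<Prod>i\<in>I. w i (f i)) * F f)"

abbreviation Pr :: "(('i \<Rightarrow> 'v) \<Rightarrow> bool) \<Rightarrow> real" where
  "Pr A \<equiv> Ex (\<lambda>f. of_bool (A f))"

lemma suppD: "f \<in> supp \<Longrightarrow> i \<in> I \<Longrightarrow> w i (f i) > 0 \<and> f i \<in> X"
  unfolding supp_def by auto

lemma weight_nonneg: "f \<in> PiE I (\<lambda>_. X) \<Longrightarrow> 0 \<le> (\<Prod>i\<in>I. w i (f i))"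
  by (intro prod_nonneg ballI w_nonneg) auto

lemma weight_outside:
  assumes "f \<in> PiE I (\<lambda>_. X)" "f \<notin> supp" shows "(\<Prod>i\<in>I. w i (f i)) = 0"
proof -
  obtain i where i: "i \<in> I" "\<not> w i (f i) > 0" using assms unfolding supp_def by auto
  moreover have "w i (f i) \<ge> 0" by (rule w_nonneg) (use i assms(1) in auto)
  ultimately have "w i (f i) = 0" by simp
  then show ?thesis using finite_I i by (intro prod_zero) auto
qed

lemma Ex_mono: assumes "\<And>f. f \<in> supp \<Longrightarrow> F f \<le> G f" shows "Ex F \<le> Ex G"
  unfolding Ex_def
proof (rule sum_mono)
  fix f assume f: "f \<in> PiE I (\<lambda>_. X)"
  show "(\<Prod>i\<in>I. w i (f i)) * F f \<le> (\<Prod>i\<in>I. w i (f i)) * G f"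
  proof (cases "f \<in> supp")
    case True then show ?thesis using assms weight_nonneg[OF f] by (intro mult_left_mono) auto
  qed (simp add: weight_outside[OF f])
qed

lemma Ex_cong: assumes "\<And>f. f \<in> supp \<Longrightarrow> F f = G f" shows "Ex F = Ex G"
  by (rule antisym; rule Ex_mono; simp add: assms)

lemma Ex_const: "Ex (\<lambda>_. c) = c"
proof -
  have "(\<Sum>f\<in>PiE I (\<lambda>_. X). \<Prod>i\<in>I. w i (f i)) = (\<Prod>i\<in>I. \<Sum>x\<in>X. w i x)"
    by (rule prod_sum_PiE[symmetric]) (auto simp: finite_I finite_X)
  also have "\<dots> = 1" by (simp add: w_sum)
  finally show ?thesis unfolding Ex_def by (simp flip: sum_distrib_right)
qed

lemma Ex_add: "Ex (\<lambda>f. F f + G f) = Ex F + Ex G"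
  unfolding Ex_def by (simp add: algebra_simps sum.distrib)

lemma Ex_diff: "Ex (\<lambda>f. F f - G f) = Ex F - Ex G"
  unfolding Ex_def by (simp add: algebra_simps sum_subtractf)

lemma Ex_cmult: "Ex (\<lambda>f. c * F f) = c * Ex F"
  unfolding Ex_def by (simp add: algebra_simps sum_distrib_left)

lemma Ex_sum: "Ex (\<lambda>f. \<Sum>j\<in>J. F j f) = (\<Sum>j\<in>J. Ex (F j))"
  unfolding Ex_def by (simp add: sum_distrib_left sum.swap[of _ _ J])

lemma Ex_nonneg: "(\<And>f. f \<in> supp \<Longrightarrow> 0 \<le> F f) \<Longrightarrow> 0 \<le> Ex F"
  using Ex_mono[of "\<lambda>_. 0" F] by (simp add: Ex_const)

lemma Ex_pos_witness:
  assumes "Ex F > 0" obtains f where "f \<in> supp" "F f > 0"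
  using assms Ex_mono[of F "\<lambda>_. 0"] by (force simp: Ex_const not_le)

text \<open>The conditional expectation given every coordinate except \<open>t\<close>.\<close>

definition avg :: "'i \<Rightarrow> (('i \<Rightarrow> 'v) \<Rightarrow> real) \<Rightarrow> ('i \<Rightarrow> 'v) \<Rightarrow> real" where
  "avg t F f = (\<Sum>x\<in>X. w t x * F (f(t := x)))"

text \<open>Fubini with \<open>t\<close> innermost: \<open>avg t F\<close> ignores coordinate
  \<open>t\<close>, whose weights sum to 1.\<close>

lemma Ex_avg: assumes "t \<in> I" shows "Ex (avg t F) = Ex F"
proof -
  define J where "J = I - {t}"
  have I: "I = insert t J" and t: "t \<notin> J" using assms by (auto simp: J_def)
  have fJ: "finite J" using finite_I by (simp add: J_def)
  have inj: "inj_on (\<lambda>(y, g). g(t := y)) (X \<times> PiE J (\<lambda>_. X))"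
  proof (rule inj_onI, clarsimp)
    fix a g b h assume *: "g \<in> PiE J (\<lambda>_. X)" "h \<in> PiE J (\<lambda>_. X)" "g(t := a) = h(t := b)"
    have "g i = h i" for i
      using * t by (cases "i = t") (auto simp: PiE_def extensional_def fun_eq_iff split: if_splits)
    then show "a = b \<and> g = h" using *(3) by (metis ext fun_upd_same)
  qed
  have Ex_split: "Ex G = (\<Sum>g\<in>PiE J (\<lambda>_. X). (\<Prod>i\<in>J. w i (g i)) * (\<Sum>y\<in>X. w t y * G (g(t := y))))" for G
  proof -
    have "Ex G = (\<Sum>(y, g)\<in>X \<times> PiE J (\<lambda>_. X). (\<Prod>i\<in>I. w i ((g(t := y)) i)) * G (g(t := y)))"
      unfolding Ex_def unfolding I PiE_insert_eq by (subst sum.reindex[OF inj]) (simp add: case_prod_unfold)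
    also have "\<dots> = (\<Sum>(y, g)\<in>X \<times> PiE J (\<lambda>_. X). (\<Prod>i\<in>J. w i (g i)) * (w t y * G (g(t := y))))"
    proof (rule sum.cong, simp, clarify)
      fix y g
      have "(\<Prod>i\<in>J. w i ((g(t := y)) i)) = (\<Prod>i\<in>J. w i (g i))"
        by (rule prod.cong) (use t in auto)
      then show "(\<Prod>i\<in>I. w i ((g(t := y)) i)) * G (g(t := y)) = (\<Prod>i\<in>J. w i (g i)) * (w t y * G (g(t := y)))"
        unfolding I using t fJ by simp
    qed
    also have "\<dots> = (\<Sum>y\<in>X. \<Sum>g\<in>PiE J (\<lambda>_. X). (\<Prod>i\<in>J. w i (g i)) * (w t y * G (g(t := y))))"
      by (rule sum.cartesian_product[symmetric])
    also have "\<dots> = (\<Sum>g\<in>PiE J (\<lambda>_. X). \<Sum>y\<in>X. (\<Prod>i\<in>J. w i (g i)) * (w t y * G (g(t := y))))"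
      by (rule sum.swap)
    finally show ?thesis by (simp add: sum_distrib_left)
  qed
  have "(\<Sum>y\<in>X. w t y * avg t F (g(t := y))) = (\<Sum>y\<in>X. w t y * F (g(t := y)))" for g
    unfolding avg_def using w_sum[OF assms] by (simp flip: sum_distrib_right)
  then show ?thesis by (simp add: Ex_split)
qed

lemma depends_avg: assumes "depends F (insert t A)" shows "depends (avg t F) A"
  unfolding avg_def
  by (rule dependsI, rule sum.cong[OF refl], rule arg_cong2[where f = times, OF refl], rule dependsD[OF assms])
     auto

text \<open>The coordinates of \<open>B\<close> are averaged out one by one. Since \<open>A\<close>
  misses them, \<open>F\<close> passes through each average as a constant factor, and in the end
  \<open>G\<close> is a constant.\<close>

lemma Ex_indep:
  assumes "finite B" "B \<subseteq> I" "depends F A" "depends G B" "A \<inter> B = {}"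
  shows "Ex (\<lambda>f. F f * G f) = Ex F * Ex G"
  using assms
proof (induction B arbitrary: G)
  case empty
  have G: "G = (\<lambda>_. G undefined)" using empty(3) by (auto simp: depends_def)
  have "Ex (\<lambda>f. F f * G f) = Ex (\<lambda>f. G undefined * F f)"
    by (subst G) (simp add: mult.commute)
  also have "\<dots> = Ex F * Ex G"
    by (subst (2) G) (simp add: Ex_cmult Ex_const)
  finally show ?case .
next
  case (insert t B)
  have "avg t (\<lambda>f. F f * G f) = (\<lambda>f. F f * avg t G f)"
    unfolding avg_def using depends_upd[OF insert(5), of t] insert(7)
    by (auto simp del: fun_upd_apply simp: fun_eq_iff sum_distrib_left mult_ac)
  then have "Ex (\<lambda>f. F f * G f) = Ex (\<lambda>f. F f * avg t G f)"
    using Ex_avg[of t "\<lambda>f. F f * G f"] insert by simp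
  also have "\<dots> = Ex F * Ex (avg t G)"
    using insert by (intro insert.IH depends_avg) auto
  finally show ?case using Ex_avg[of t G] insert by simp
qed

lemma Ex_single: assumes "t \<in> I" shows "Ex (\<lambda>f. y (f t)) = (\<Sum>x\<in>X. w t x * y x)"
  using Ex_avg[OF assms, of "\<lambda>f. y (f t)"] by (simp add: avg_def[abs_def] Ex_const)

lemma sum_of_bool_inter: "(\<Sum>x\<in>X. h x * of_bool (x \<in> K)) = (\<Sum>x\<in>X \<inter> K. h x)" for h :: "'v \<Rightarrow> real"
  by (auto simp: sum.inter_restrict[OF finite_X] intro: sum.cong)

lemma Pr_mono: "(\<And>f. f \<in> supp \<Longrightarrow> A f \<Longrightarrow> B f) \<Longrightarrow> Pr A \<le> Pr B"
  by (rule Ex_mono) auto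

lemma Pr_Bex_le:
  assumes "finite J" shows "Pr (\<lambda>f. \<exists>j\<in>J. A j f) \<le> (\<Sum>j\<in>J. Pr (A j))"
proof -
  have "of_bool (\<exists>j\<in>J. A j f) \<le> (\<Sum>j\<in>J. of_bool (A j f) :: real)" for f
  proof (cases "\<exists>j\<in>J. A j f")
    case True
    then obtain j where "j \<in> J" "A j f" by blast
    then show ?thesis using member_le_sum[of j J "\<lambda>j. of_bool (A j f) :: real"] assms by simp
  qed (simp add: sum_nonneg)
  then show ?thesis unfolding Ex_sum[symmetric] by (intro Ex_mono)
qed

lemma Ex_indep_prod:
  assumes "finite G" "\<And>g. g \<in> G \<Longrightarrow> depends (F g) (D g)" "\<And>g. g \<in> G \<Longrightarrow> D g \<subseteq> I"
    "disjoint_family_on D G"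
  shows "Ex (\<lambda>f. \<Prod>g\<in>G. F g f) = (\<Prod>g\<in>G. Ex (F g))"
  using assms
proof (induction G)
  case empty then show ?case by (simp add: Ex_const)
next
  case (insert g G)
  have d: "D g \<inter> (\<Union>g\<in>G. D g) = {}"
    using insert(2,6) by (fastforce simp: disjoint_family_on_def)
  have "Ex (\<lambda>f. F g f * (\<Prod>g\<in>G. F g f)) = Ex (F g) * Ex (\<lambda>f. \<Prod>g\<in>G. F g f)"
    by (rule Ex_indep[OF _ _ insert(4)[of g] depends_prod d])
       (use insert finite_I in \<open>auto intro: finite_subset\<close>)
  also have "Ex (\<lambda>f. \<Prod>g\<in>G. F g f) = (\<Prod>g\<in>G. Ex (F g))"
    using insert by (intro insert.IH) (auto simp: disjoint_family_on_def)
  finally show ?case using insert by simp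
qed

text \<open>Independence turns the probability into a product of factors 1 - p, and 1 - p \<le> exp
  (- p). Only the total mass of the forbidden values enters, so the coins introduced later merely
  have to equalise this total.\<close>

lemma Pr_avoid_le:
  assumes "A \<subseteq> I"
  shows "Pr (\<lambda>f. \<forall>t\<in>A. f t \<notin> K t) \<le> exp (- (\<Sum>t\<in>A. \<Sum>x\<in>X \<inter> K t. w t x))"
proof -
  have fA: "finite A" using assms finite_I finite_subset by blast
  have "of_bool (\<forall>t\<in>A. f t \<notin> K t) = (\<Prod>t\<in>A. of_bool (f t \<notin> K t) :: real)" for f
    using fA by (induction A) auto
  then have "Pr (\<lambda>f. \<forall>t\<in>A. f t \<notin> K t) = Ex (\<lambda>f. \<Prod>t\<in>A. of_bool (f t \<notin> K t))" by simp
  also have "\<dots> = (\<Prod>t\<in>A. Ex (\<lambda>f. of_bool (f t \<notin> K t)))"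
    by (rule Ex_indep_prod[where D = "\<lambda>t. {t}"])
       (use fA assms in \<open>auto simp: depends_def disjoint_family_on_def\<close>)
  also have "\<dots> \<le> (\<Prod>t\<in>A. exp (- (\<Sum>x\<in>X \<inter> K t. w t x)))"
  proof (intro prod_mono conjI Ex_nonneg)
    fix t assume t: "t \<in> A"
    have "Ex (\<lambda>f. of_bool (f t \<notin> K t)) = (\<Sum>x\<in>X. w t x * of_bool (x \<notin> K t))"
      using t assms by (intro Ex_single) auto
    also have "\<dots> = (\<Sum>x\<in>X. w t x - w t x * of_bool (x \<in> K t))"
      by (intro sum.cong) auto
    also have "\<dots> = 1 - (\<Sum>x\<in>X \<inter> K t. w t x)"
      using w_sum[of t] t assms by (auto simp: sum_subtractf sum_of_bool_inter)
    also have "\<dots> \<le> exp (- (\<Sum>x\<in>X \<inter> K t. w t x))"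
      using exp_ge_add_one_self[of "- (\<Sum>x\<in>X \<inter> K t. w t x)"] by simp
    finally show "Ex (\<lambda>f. of_bool (f t \<notin> K t)) \<le> exp (- (\<Sum>x\<in>X \<inter> K t. w t x))" .
  qed auto
  also have "\<dots> = exp (- (\<Sum>t\<in>A. \<Sum>x\<in>X \<inter> K t. w t x))"
    using fA by (simp add: exp_sum sum_negf[symmetric])
  finally show ?thesis .
qed

section \<open>Exponential moments and tail bounds\<close>

lemma markov_exp:
  assumes "0 \<le> l" shows "Pr (\<lambda>f. Y f \<ge> b) \<le> exp (- l * b) * Ex (\<lambda>f. exp (l * Y f))"
proof -
  have "of_bool (Y f \<ge> b) \<le> exp (- l * b) * exp (l * Y f)" for f
  proof (cases "Y f \<ge> b")
    case True
    then have "0 \<le> - l * b + l * Y f" using assms by (simp add: mult_left_mono)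
    then show ?thesis by (simp flip: exp_add)
  qed simp
  then show ?thesis unfolding Ex_cmult[symmetric] by (intro Ex_mono)
qed

text \<open>This is exp z \<le> 1 + z + z^2 for z in [0, 1], with one factor \<open>y\<close> of the
  square replaced by \<open>C\<close>. The bound is linear in \<open>y\<close>, so expectations can
  be taken on both sides.\<close>

lemma exp_le_chord:
  fixes l y C :: real
  assumes "0 \<le> l" "l * C \<le> 1" "0 \<le> y" "y \<le> C"
  shows "exp (l * y) \<le> 1 + (l + l\<^sup>2 * C) * y"
proof -
  have "l * y \<le> 1" using assms mult_left_mono[of y C l] by simp
  then have "exp (l * y) \<le> 1 + l * y + (l * y)\<^sup>2" using assms by (intro exp_bound) auto
  also have "(l * y)\<^sup>2 \<le> l\<^sup>2 * C * y"
    using assms mult_left_mono[of "y * y" "C * y" "l * l"] mult_right_mono[of y C y]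
    by (simp add: power2_eq_square mult_ac)
  finally show ?thesis by (simp add: algebra_simps)
qed

text \<open>The common ending of the independent and the sequential tail bound. The parameter
  \<open>l\<close> stays free here; \<open>\<omega>_bound\<close> evaluates the exponent for the
  choice made later.\<close>

lemma chernoff_aux:
  fixes l C \<mu> s :: real
  assumes "0 \<le> l" "0 \<le> C" "Ex (\<lambda>f. exp (l * Y f)) \<le> exp ((l + l\<^sup>2 * C) * \<mu>)"
  shows "Pr (\<lambda>f. Y f \<ge> \<mu> + s) \<le> exp (l\<^sup>2 * C * \<mu> - l * s)"
proof -
  have "Pr (\<lambda>f. Y f \<ge> \<mu> + s) \<le> exp (- l * (\<mu> + s)) * Ex (\<lambda>f. exp (l * Y f))"
    by (rule markov_exp[OF assms(1)])
  also have "\<dots> \<le> exp (- l * (\<mu> + s)) * exp ((l + l\<^sup>2 * C) * \<mu>)" using assms by simp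
  also have "\<dots> = exp (l\<^sup>2 * C * \<mu> - l * s)" by (simp add: algebra_simps flip: exp_add)
  finally show ?thesis .
qed

lemma chernoff_indep:
  fixes l C \<mu> s :: real
  assumes "finite G" "\<And>g. g \<in> G \<Longrightarrow> depends (Y g) (D g)" "\<And>g. g \<in> G \<Longrightarrow> D g \<subseteq> I"
    "disjoint_family_on D G"
    and Y: "\<And>g f. g \<in> G \<Longrightarrow> f \<in> supp \<Longrightarrow> 0 \<le> Y g f \<and> Y g f \<le> C"
    and \<mu>: "(\<Sum>g\<in>G. Ex (Y g)) \<le> \<mu>" and l: "0 \<le> l" "l * C \<le> 1" "0 \<le> C"
  shows "Pr (\<lambda>f. (\<Sum>g\<in>G. Y g f) \<ge> \<mu> + s) \<le> exp (l\<^sup>2 * C * \<mu> - l * s)"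
proof (rule chernoff_aux[OF l(1,3)])
  let ?z = "l + l\<^sup>2 * C"
  have z: "?z \<ge> 0" using l by simp
  have "Ex (\<lambda>f. exp (l * (\<Sum>g\<in>G. Y g f))) = Ex (\<lambda>f. \<Prod>g\<in>G. exp (l * Y g f))"
    using assms(1) by (simp add: sum_distrib_left exp_sum)
  also have "\<dots> = (\<Prod>g\<in>G. Ex (\<lambda>f. exp (l * Y g f)))"
    using assms(1-4) by (intro Ex_indep_prod) (auto intro: depends_compose)
  also have "\<dots> \<le> (\<Prod>g\<in>G. exp (?z * Ex (Y g)))"
  proof (intro prod_mono conjI Ex_nonneg)
    fix g assume g: "g \<in> G"
    have "Ex (\<lambda>f. exp (l * Y g f)) \<le> Ex (\<lambda>f. 1 + ?z * Y g f)"
      using Y[OF g] l by (intro Ex_mono exp_le_chord) auto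
    also have "\<dots> = 1 + ?z * Ex (Y g)" by (simp only: Ex_add Ex_cmult Ex_const)
    also have "\<dots> \<le> exp (?z * Ex (Y g))" by (rule exp_ge_add_one_self)
    finally show "Ex (\<lambda>f. exp (l * Y g f)) \<le> exp (?z * Ex (Y g))" .
  qed auto
  also have "\<dots> = exp (?z * (\<Sum>g\<in>G. Ex (Y g)))"
    using assms(1) by (simp add: exp_sum sum_distrib_left)
  also have "\<dots> \<le> exp (?z * \<mu>)" using \<mu> z by (simp add: mult_left_mono)
  finally show "Ex (\<lambda>f. exp (l * (\<Sum>g\<in>G. Y g f))) \<le> exp (?z * \<mu>)" .
qed

text \<open>The trials are averaged out in decreasing order of rank, so that the sets \<open>K t\<close> of the
  remaining trials \<open>t\<close> stay fixed.\<close>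

lemma chernoff_seq:
  fixes l C \<mu> s :: real and rank :: "'i \<Rightarrow> nat"
  assumes R: "R \<subseteq> I"
    and dep: "\<And>t. t \<in> R \<Longrightarrow> depends (K t) (P t)"
    and P: "\<And>t u. t \<in> R \<Longrightarrow> u \<in> R \<Longrightarrow> rank t \<le> rank u \<Longrightarrow> u \<notin> P t"
    and inj: "inj_on rank R"
    and K: "\<And>t f. t \<in> R \<Longrightarrow> (\<Sum>x\<in>X \<inter> K t f. w t x) \<le> \<pi>"
    and c: "\<And>t. t \<in> R \<Longrightarrow> 0 \<le> c t \<and> c t \<le> C"
    and \<mu>: "\<pi> * (\<Sum>t\<in>R. c t) \<le> \<mu>" and l: "0 \<le> l" "l * C \<le> 1" "0 \<le> C"
  shows "Pr (\<lambda>f. (\<Sum>t\<in>R. c t * of_bool (f t \<in> K t f)) \<ge> \<mu> + s) \<le> exp (l\<^sup>2 * C * \<mu> - l * s)"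
proof (rule chernoff_aux[OF l(1,3)])
  let ?z = "l + l\<^sup>2 * C"
  let ?e = "\<lambda>t f. exp (l * (c t * of_bool (f t \<in> K t f)))"
  have z: "?z \<ge> 0" using l by simp
  have fR: "finite R" using R finite_I finite_subset by blast
  have "Ex (\<lambda>f. \<Prod>t\<in>R. ?e t f) \<le> (\<Prod>t\<in>R. exp (?z * (\<pi> * c t)))"
    using fR R dep P inj K c
  proof (induction R rule: finite_ranking_induct[where f = rank])
    case empty show ?case by (simp add: Ex_const)
  next
    case (insert t R)
    show ?case
    proof (cases "t \<in> R")
      case True
      then show ?thesis using insert by (simp add: insert_absorb)
    next
      case t: False
      have tI: "t \<in> I" using insert by blast
      have notP: "t \<notin> P u" if "u \<in> insert t R" for u
        using that insert(2) insert.prems(3)[of u t] by auto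
      have ne: "u \<noteq> t" if "u \<in> R" for u using that t by auto
      have upd: "K u (f(t := x)) = K u f" if "u \<in> insert t R" for u f x
        using depends_upd[OF insert.prems(2)[OF that] notP[OF that]] .
      have c0: "0 \<le> c t" "c t \<le> C" using insert.prems(6)[of t] by auto
      have ct: "avg t (?e t) f \<le> exp (?z * (\<pi> * c t))" for f
      proof -
        have "avg t (?e t) f = (\<Sum>x\<in>X. w t x * exp (l * (c t * of_bool (x \<in> K t f))))"
          unfolding avg_def using upd[of t] by simp
        also have "\<dots> \<le> (\<Sum>x\<in>X. w t x * (1 + ?z * (c t * of_bool (x \<in> K t f))))"
          using c0 l w_nonneg[OF tI] by (intro sum_mono mult_left_mono exp_le_chord) auto
        also have "\<dots> = (\<Sum>x\<in>X. w t x) + ?z * c t * (\<Sum>x\<in>X. w t x * of_bool (x \<in> K t f))"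
          by (simp add: algebra_simps sum.distrib sum_distrib_left)
        also have "(\<Sum>x\<in>X. w t x * of_bool (x \<in> K t f)) = (\<Sum>x\<in>X \<inter> K t f. w t x)"
          by (rule sum_of_bool_inter)
        also have "(\<Sum>x\<in>X. w t x) + ?z * c t * (\<Sum>x\<in>X \<inter> K t f. w t x) \<le> 1 + ?z * c t * \<pi>"
          using w_sum[OF tI] insert.prems(5)[of t f] c0 z by (simp add: mult_left_mono)
        also have "\<dots> \<le> exp (?z * (\<pi> * c t))"
          using exp_ge_add_one_self[of "?z * (\<pi> * c t)"] by (simp add: mult_ac)
        finally show ?thesis .
      qed
      have "Ex (\<lambda>f. \<Prod>u\<in>insert t R. ?e u f) = Ex (avg t (\<lambda>f. \<Prod>u\<in>insert t R. ?e u f))"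
        by (rule Ex_avg[OF tI, symmetric])
      \<comment> \<open>Overwriting \<open>t\<close> changes neither \<open>K u\<close> nor the
        value at \<open>u\<close> for the remaining trials \<open>u\<close>, so their factors leave
        the average.\<close>
      also have "avg t (\<lambda>f. \<Prod>u\<in>insert t R. ?e u f) = (\<lambda>f. avg t (?e t) f * (\<Prod>u\<in>R. ?e u f))"
      proof
        fix f
        have "(\<Prod>u\<in>R. ?e u (f(t := x))) = (\<Prod>u\<in>R. ?e u f)" for x
          using upd ne by (intro prod.cong) auto
        then show "avg t (\<lambda>f. \<Prod>u\<in>insert t R. ?e u f) f = avg t (?e t) f * (\<Prod>u\<in>R. ?e u f)"
          unfolding avg_def using t insert(1) by (simp del: fun_upd_apply add: sum_distrib_left mult_ac)
      qed
      also have "Ex \<dots> \<le> Ex (\<lambda>f. exp (?z * (\<pi> * c t)) * (\<Prod>u\<in>R. ?e u f))"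
        using ct by (intro Ex_mono mult_right_mono prod_nonneg) auto
      also have "\<dots> = exp (?z * (\<pi> * c t)) * Ex (\<lambda>f. \<Prod>u\<in>R. ?e u f)"
        by (rule Ex_cmult)
      also have "\<dots> \<le> exp (?z * (\<pi> * c t)) * (\<Prod>u\<in>R. exp (?z * (\<pi> * c u)))"
        using insert.prems by (intro mult_left_mono insert.IH) (auto simp: inj_on_insert)
      finally show ?thesis using t insert(1) by simp
    qed
  qed
  also have "\<dots> = exp (?z * (\<pi> * (\<Sum>t\<in>R. c t)))"
    using fR by (simp add: exp_sum sum_distrib_left)
  also have "\<dots> \<le> exp (?z * \<mu>)" using \<mu> z by (simp add: mult_left_mono)
  finally show "Ex (\<lambda>f. exp (l * (\<Sum>t\<in>R. c t * of_bool (f t \<in> K t f)))) \<le> exp (?z * \<mu>)"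
    unfolding sum_distrib_left exp_sum[OF fR] .
qed

text \<open>The symmetric Local Lemma with constant 4. The count bounded by \<open>d\<close>
  includes the event itself, so that d \<ge> 1 as soon as there is an event.\<close>

lemma local_lemma:
  fixes p d :: real
  assumes J: "finite J"
    and dep: "\<And>j. j \<in> J \<Longrightarrow> depends (A j) (vbl j)" and vbl: "\<And>j. j \<in> J \<Longrightarrow> vbl j \<subseteq> I"
    and p: "\<And>j. j \<in> J \<Longrightarrow> Pr (A j) \<le> p"
    and d: "\<And>j. j \<in> J \<Longrightarrow> real (card {i \<in> J. i = j \<or> vbl j \<inter> vbl i \<noteq> {}}) \<le> d"
    and pd: "4 * p * d \<le> 1"
  shows "\<exists>f\<in>supp. \<forall>j\<in>J. \<not> A j f"
proof (cases "J = {}")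
  case True
  have "Ex (\<lambda>_. 1) > 0" by (simp add: Ex_const)
  then obtain f where "f \<in> supp" by (rule Ex_pos_witness)
  then show ?thesis using True by auto
next
  case False
  then obtain j0 where j0: "j0 \<in> J" by blast
  have "real (card {j0}) \<le> real (card {i \<in> J. i = j0 \<or> vbl j0 \<inter> vbl i \<noteq> {}})"
    using J j0 by (intro of_nat_mono card_mono) auto
  then have d1: "d \<ge> 1" using d[OF j0] by simp
  have p0: "p \<ge> 0" using p[OF j0] Ex_nonneg[of "\<lambda>f. of_bool (A j0 f)"] by simp
  have p4: "p \<le> 1/4" using pd d1 p0 mult_left_mono[of 1 d p] by simp
  define N where "N S = Pr (\<lambda>f. \<forall>j\<in>S. \<not> A j f)" for S
  have depN: "depends (\<lambda>f. of_bool (\<forall>j\<in>S. \<not> A j f) :: real) (\<Union>j\<in>S. vbl j)" if "S \<subseteq> J" for S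
  proof (rule dependsI)
    fix f g :: "'i \<Rightarrow> 'v" assume fg: "\<And>i. i \<in> (\<Union>j\<in>S. vbl j) \<Longrightarrow> f i = g i"
    have "A j f = A j g" if "j \<in> S" for j
      using that \<open>S \<subseteq> J\<close> fg by (intro dependsD[OF dep]) auto
    then show "of_bool (\<forall>j\<in>S. \<not> A j f) = (of_bool (\<forall>j\<in>S. \<not> A j g) :: real)" by simp
  qed
  \<comment> \<open>A form without division of the usual claim: conditioned on no event of
    \<open>S\<close>, any further event has probability at most 2 p. Positivity, which makes the
    condition meaningful, is proved in the same induction.\<close>
  have main: "N S > 0 \<and> (\<forall>j\<in>J - S. Pr (\<lambda>f. A j f \<and> (\<forall>i\<in>S. \<not> A i f)) \<le> 2 * p * N S)"
    if "S \<subseteq> J" for S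
    using finite_subset[OF that J] that
  proof (induction S rule: finite_psubset_induct)
    case (psubset S)
    have pos: "N S > 0"
    proof (cases "S = {}")
      case True then show ?thesis by (simp add: N_def Ex_const)
    next
      case False
      then obtain j where j: "j \<in> S" by blast
      let ?T = "S - {j}"
      have T: "?T \<subset> S" "?T \<subseteq> J" "j \<in> J - ?T" using j psubset by auto
      have "N S = N ?T - Pr (\<lambda>f. A j f \<and> (\<forall>i\<in>?T. \<not> A i f))"
        unfolding N_def Ex_diff[symmetric] using j by (intro Ex_cong) auto
      moreover have "Pr (\<lambda>f. A j f \<and> (\<forall>i\<in>?T. \<not> A i f)) \<le> 2 * p * N ?T" "N ?T > 0"
        using psubset.IH[OF T(1,2)] T(3) by auto
      moreover have "2 * p * N ?T \<le> 1/2 * N ?T"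
        using p4 \<open>N ?T > 0\<close> by (intro mult_right_mono) auto
      ultimately show ?thesis by linarith
    qed
    have "Pr (\<lambda>f. A j f \<and> (\<forall>i\<in>S. \<not> A i f)) \<le> 2 * p * N S" if j: "j \<in> J - S" for j
    proof -
      \<comment> \<open>\<open>A j\<close> is independent of the events in \<open>S2\<close>.
        Dropping the conditions in \<open>S1\<close> only enlarges the left side and leaves the
        product Pr (A j) * N S2; by \<open>half\<close>, restoring them on the right side costs at
        most a factor 2.\<close>
      define S1 where "S1 = {i \<in> S. vbl j \<inter> vbl i \<noteq> {}}"
      define S2 where "S2 = S - S1"
      have S2J: "S2 \<subseteq> J" using psubset by (auto simp: S2_def)
      have fS1: "finite S1" using psubset by (auto simp: S1_def)
      have N2: "N S2 \<ge> 0" unfolding N_def by (rule Ex_nonneg) auto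
      have "real (card S1) \<le> real (card {i \<in> J. i = j \<or> vbl j \<inter> vbl i \<noteq> {}})"
        using J psubset(3) by (intro of_nat_mono card_mono) (auto simp: S1_def)
      then have cS1: "real (card S1) \<le> d" using d[of j] j by simp
      \<comment> \<open>A union bound over at most \<open>d\<close> events, each of relative
        probability at most 2 p given \<open>S2\<close>, removes at most 2 p d \<le> 1/2. If
        \<open>S1\<close> is empty, \<open>S2\<close> is no proper subset of \<open>S\<close>, so
        that case is separate.\<close>
      have half: "N S2 \<le> 2 * N S"
      proof (cases "S1 = {}")
        case True then show ?thesis using pos by (simp add: S2_def)
      next
        case False
        then have S2S: "S2 \<subset> S" by (auto simp: S2_def S1_def)
        have "N S2 - N S \<le> Pr (\<lambda>f. \<exists>i\<in>S1. A i f \<and> (\<forall>i\<in>S2. \<not> A i f))"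
          unfolding N_def Ex_diff[symmetric] by (rule Ex_mono) (auto simp: S2_def)
        also have "\<dots> \<le> (\<Sum>i\<in>S1. Pr (\<lambda>f. A i f \<and> (\<forall>i\<in>S2. \<not> A i f)))"
          by (rule Pr_Bex_le[OF fS1])
        also have "\<dots> \<le> (\<Sum>i\<in>S1. 2 * p * N S2)"
          using psubset.IH[OF S2S S2J] psubset(3) by (intro sum_mono) (auto simp: S1_def S2_def)
        also have "\<dots> = 2 * (p * real (card S1)) * N S2" by simp
        also have "\<dots> \<le> 2 * (p * d) * N S2"
          using cS1 p0 N2 by (intro mult_right_mono mult_left_mono) auto
        also have "\<dots> \<le> 1/2 * N S2" using pd N2 by (intro mult_right_mono) auto
        finally show ?thesis by simp
      qed
      have "Pr (\<lambda>f. A j f \<and> (\<forall>i\<in>S. \<not> A i f)) \<le> Pr (\<lambda>f. (\<forall>i\<in>S2. \<not> A i f) \<and> A j f)"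
        by (rule Pr_mono) (auto simp: S2_def)
      also have "\<dots> = Ex (\<lambda>f. of_bool (\<forall>i\<in>S2. \<not> A i f) * of_bool (A j f))"
        by (intro Ex_cong) simp
      also have "\<dots> = N S2 * Pr (A j)"
        unfolding N_def
        by (rule Ex_indep[OF _ vbl depN[OF S2J] depends_compose[OF dep]])
           (use j vbl[of j] finite_I finite_subset in \<open>auto simp: S2_def S1_def\<close>)
      also have "\<dots> \<le> N S2 * p" using N2 p[of j] j by (intro mult_left_mono) auto
      also have "\<dots> \<le> 2 * N S * p" using half p0 by (intro mult_right_mono) auto
      finally show ?thesis by (simp add: mult_ac)
    qed
    then show ?case using pos by blast
  qed
  have "Pr (\<lambda>f. \<forall>j\<in>J. \<not> A j f) > 0" using main[OF subset_refl] by (simp add: N_def)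
  then obtain f where "f \<in> supp" "of_bool (\<forall>j\<in>J. \<not> A j f) > (0::real)" by (rule Ex_pos_witness)
  then show ?thesis by (auto simp: of_bool_def split: if_splits)
qed

end

subsection \<open>One round of random picks\<close>

text \<open>\<open>Pick i c\<close> is the pick of a pair, \<open>None\<close> meaning that the pair
  is not activated. \<open>Disc v\<close> and \<open>Kill v c\<close> are the coins that discard
  \<open>v\<close> altogether or strike it from the list of colour \<open>c\<close>; they show
  \<open>Some v\<close> when they strike.\<close>

datatype 'a trial = Pick nat nat | Disc 'a | Kill 'a nat

text \<open>The number of parts is finite but otherwise arbitrary. Part sizes, degrees and the
  number \<open>m\<close> of colours are at most \<open>n\<close>, which makes all counts of
  dependent events polynomial in \<open>n\<close>.\<close>

locale part_graph =
  fixes P :: "nat set" and U :: "'a set" and pt :: "'a \<Rightarrow> nat" and E :: "'a \<Rightarrow> 'a \<Rightarrow> bool"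
    and n m C :: nat
  assumes finite_P: "finite P" and finite_U: "finite U"
    and pt_P: "\<And>u. u \<in> U \<Longrightarrow> pt u \<in> P"
    and E_sym: "\<And>u v. E u v \<Longrightarrow> E v u" and E_U: "\<And>u v. E u v \<Longrightarrow> u \<in> U"
    and E_pt: "\<And>u v. E u v \<Longrightarrow> pt u \<noteq> pt v"
    and card_part: "\<And>i. card {v \<in> U. pt v = i} \<le> n"
    and degree: "\<And>v. card {u. E v u} \<le> n"
    and local_deg: "\<And>v i. card {u. E v u \<and> pt u = i} \<le> C"
    and C_pos: "C \<ge> 1" and m_le: "m \<le> n" and n_pos: "n \<ge> 1"
begin

lemma E_U2: "E u v \<Longrightarrow> v \<in> U"
  using E_U E_sym by blast

lemma finite_nbrs: "finite {u. E v u}" "finite {u. E v u \<and> Q u}" "finite {u \<in> S. E v u \<and> Q u}"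
  by (rule finite_subset[OF _ finite_U]; use E_U2 in blast)+

text \<open>Balls of radius 1, and with \<open>ball2\<close> of radius 2, in the graph on part
  indices in which two parts are adjacent if some edge joins them.\<close>

definition ball1 :: "nat \<Rightarrow> nat set" where
  "ball1 i = insert i {pt v |u v. E u v \<and> pt u = i}"

definition ball2 :: "nat \<Rightarrow> nat set" where
  "ball2 i = (\<Union>j\<in>ball1 i. ball1 j)"

lemma ball1_sym: "j \<in> ball1 i \<longleftrightarrow> i \<in> ball1 j"
  unfolding ball1_def using E_sym by blast

lemma ball1_self: "i \<in> ball1 i"
  by (simp add: ball1_def)

lemma ball1_nbr: "E v u \<Longrightarrow> pt u \<in> ball1 (pt v)"
  by (auto simp: ball1_def)

lemma ball2_sym: "j \<in> ball2 i \<longleftrightarrow> i \<in> ball2 j"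
  unfolding ball2_def using ball1_sym by blast

lemma ball1_subset_ball2: "ball1 i \<subseteq> ball2 i"
  using ball1_self by (auto simp: ball2_def)

text \<open>At most \<open>n\<close> vertices in part \<open>i\<close>, each with at most
  \<open>n\<close> neighbours, plus \<open>i\<close> itself.\<close>

lemma card_ball1: "finite (ball1 i) \<and> card (ball1 i) \<le> n\<^sup>2 + 1"
proof -
  let ?W = "{v \<in> U. pt v = i}"
  have eq: "{pt v |u v. E u v \<and> pt u = i} = (\<Union>u\<in>?W. pt ` {v. E u v})"
    using E_U by blast
  have "card (\<Union>u\<in>?W. pt ` {v. E u v}) \<le> (\<Sum>u\<in>?W. card (pt ` {v. E u v}))"
    using finite_U by (intro card_UN_le) auto
  also have "\<dots> \<le> (\<Sum>u\<in>?W. n)"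
    using card_image_le[OF finite_nbrs(1)] degree le_trans by (intro sum_mono) blast
  also have "\<dots> \<le> n * n" using card_part by simp
  finally have "card {pt v |u v. E u v \<and> pt u = i} \<le> n\<^sup>2" by (simp add: eq power2_eq_square)
  moreover have "finite {pt v |u v. E u v \<and> pt u = i}"
    unfolding eq using finite_U finite_nbrs by auto
  ultimately show ?thesis unfolding ball1_def by (simp add: card_insert_if)
qed

lemma card_UN_mult:
  assumes "finite A \<and> card A \<le> x" "\<And>i. finite (B i) \<and> card (B i) \<le> (y :: nat)"
  shows "finite (\<Union>i\<in>A. B i) \<and> card (\<Union>i\<in>A. B i) \<le> x * y"
proof -
  have "card (\<Union>i\<in>A. B i) \<le> (\<Sum>i\<in>A. card (B i))" using assms by (intro card_UN_le) auto
  also have "\<dots> \<le> (\<Sum>i\<in>A. y)" using assms by (intro sum_mono) auto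
  also have "\<dots> \<le> x * y" using assms by simp
  finally show ?thesis using assms by auto
qed

lemma card_ball2: "finite (ball2 i) \<and> card (ball2 i) \<le> (n\<^sup>2 + 1)\<^sup>2"
  unfolding ball2_def power2_eq_square[of "_ + _"] by (intro card_UN_mult card_ball1)

end

locale nibble_state = part_graph P U pt E n m C
  for P :: "nat set" and U :: "'a set" and pt :: "'a \<Rightarrow> nat" and E :: "'a \<Rightarrow> 'a \<Rightarrow> bool"
    and n m C :: nat +
  fixes a e :: real and g :: "nat \<Rightarrow> nat \<Rightarrow> 'a option" and S :: "'a set" and L :: "nat \<Rightarrow> nat \<Rightarrow> 'a set"
  assumes S_U: "S \<subseteq> U"
    and col: "\<And>i c v. i \<in> P \<Longrightarrow> c < m \<Longrightarrow> g i c = Some v \<Longrightarrow> v \<in> U \<and> pt v = i \<and> v \<notin> S"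
    and col_inj: "\<And>i c c' v. i \<in> P \<Longrightarrow> c < m \<Longrightarrow> c' < m \<Longrightarrow> g i c = Some v \<Longrightarrow> g i c' = Some v \<Longrightarrow> c = c'"
    and col_indep: "\<And>i j c u v. i \<in> P \<Longrightarrow> j \<in> P \<Longrightarrow> c < m \<Longrightarrow> g i c = Some u \<Longrightarrow> g j c = Some v \<Longrightarrow> \<not> E u v"
    and L_S: "\<And>i c. i \<in> P \<Longrightarrow> c < m \<Longrightarrow> g i c = None \<Longrightarrow> L i c \<subseteq> {v \<in> S. pt v = i}"
    and L_indep: "\<And>i j c u v. i \<in> P \<Longrightarrow> j \<in> P \<Longrightarrow> c < m \<Longrightarrow> g i c = None \<Longrightarrow> u \<in> L i c \<Longrightarrow> g j c = Some v \<Longrightarrow> \<not> E u v"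
    and card_L: "\<And>i c. i \<in> P \<Longrightarrow> c < m \<Longrightarrow> g i c = None \<Longrightarrow> a \<le> real (card (L i c))"
    and card_H: "\<And>v. v \<in> U \<Longrightarrow> real (card {c. c < m \<and> g (pt v) c = None \<and> v \<in> L (pt v) c}) \<le> e"
    and card_N: "\<And>v c. v \<in> U \<Longrightarrow> c < m \<Longrightarrow> real (card {u \<in> S. E v u \<and> g (pt u) c = None}) \<le> e"

text \<open>The slack \<open>s\<close> is the additive deviation granted to each random quantity.
  The bound on 2 \<theta> e keeps \<open>y\<close> at most 1/2.\<close>

locale nibble_step = nibble_state P U pt E n m C a e g S L
  for P :: "nat set" and U :: "'a set" and pt :: "'a \<Rightarrow> nat" and E :: "'a \<Rightarrow> 'a \<Rightarrow> bool"
    and n m C :: nat and a e :: real and g S L +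
  fixes \<theta> s :: real
  assumes \<theta>: "0 < \<theta>" "\<theta> \<le> 1" and a_pos: "a > 0" and e_pos: "e \<ge> 0" and \<theta>e: "2 * \<theta> * e \<le> a"
    and e_le: "e \<le> n" and s: "0 < s" "s \<le> n"
begin

section \<open>The probability space of a round\<close>

definition y :: real where "y = \<theta> * e / a"

text \<open>A pair coloured already keeps a trial, with the certain value \<open>None\<close>, so
  that the set of trials is the same in every state.\<close>

definition wP :: "nat \<Rightarrow> nat \<Rightarrow> 'a option \<Rightarrow> real" where
  "wP i c x = (if g i c = None
     then (case x of None \<Rightarrow> 1 - \<theta> | Some v \<Rightarrow> if v \<in> L i c then \<theta> / card (L i c) else 0)
     else of_bool (x = None))"

text \<open>The expected number of picks of \<open>v\<close>; likewise \<open>blocked v c\<close> is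
  the expected number of neighbours of \<open>v\<close> picked for colour \<open>c\<close>.\<close>

definition used :: "'a \<Rightarrow> real" where
  "used v = (\<Sum>c<m. wP (pt v) c (Some v))"

definition blocked :: "'a \<Rightarrow> nat \<Rightarrow> real" where
  "blocked v c = (\<Sum>u | E v u. wP (pt u) c (Some u))"

text \<open>The coins raise the expected number of trials hitting \<open>v\<close>, or \<open>(v, c)\<close>, to exactly \<open>y\<close>.\<close>

definition coin :: "real \<Rightarrow> 'a \<Rightarrow> 'a option \<Rightarrow> real" where
  "coin q v x = (case x of None \<Rightarrow> 1 - q | Some u \<Rightarrow> if u = v then q else 0)"

definition wt :: "'a trial \<Rightarrow> 'a option \<Rightarrow> real" where
  "wt t x = (case t of Pick i c \<Rightarrow> wP i c x | Disc v \<Rightarrow> coin (y - used v) v x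
     | Kill v c \<Rightarrow> coin (y - blocked v c) v x)"

definition trials :: "'a trial set" where
  "trials = (\<lambda>(i, c). Pick i c) ` (P \<times> {..<m}) \<union> Disc ` U \<union> (\<lambda>(v, c). Kill v c) ` (U \<times> {..<m})"

definition outcomes :: "'a option set" where
  "outcomes = insert None (Some ` U)"

lemma finite_outcomes: "finite outcomes"
  using finite_U by (simp add: outcomes_def)

lemma sum_outcomes: "(\<Sum>x\<in>outcomes. h x) = h None + (\<Sum>u\<in>U. h (Some u))" for h :: "'a option \<Rightarrow> real"
  unfolding outcomes_def by (subst sum.insert) (auto simp: finite_U sum.reindex)

lemma sum_trials:
  "(\<Sum>t\<in>trials. h t) = (\<Sum>i\<in>P. \<Sum>c<m. h (Pick i c)) + (\<Sum>v\<in>U. h (Disc v)) + (\<Sum>v\<in>U. \<Sum>c<m. h (Kill v c))"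
  for h :: "'a trial \<Rightarrow> real"
proof -
  have 1: "(\<Sum>t\<in>(\<lambda>(i, c). Pick i c) ` (P \<times> {..<m}). h t) = (\<Sum>i\<in>P. \<Sum>c<m. h (Pick i c))"
    by (subst sum.reindex) (auto simp: inj_on_def sum.cartesian_product intro!: sum.cong)
  have 2: "(\<Sum>t\<in>Disc ` U. h t) = (\<Sum>v\<in>U. h (Disc v))"
    by (subst sum.reindex) (auto simp: inj_on_def)
  have 3: "(\<Sum>t\<in>(\<lambda>(v, c). Kill v c) ` (U \<times> {..<m}). h t) = (\<Sum>v\<in>U. \<Sum>c<m. h (Kill v c))"
    by (subst sum.reindex) (auto simp: inj_on_def sum.cartesian_product intro!: sum.cong)
  show ?thesis unfolding trials_def
    by (subst sum.union_disjoint, use finite_P finite_U in \<open>auto simp: 1 2 3\<close>,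
        subst sum.union_disjoint, auto simp: 1 2 3)
qed

lemma Pick_trials: "Pick i c \<in> trials \<longleftrightarrow> i \<in> P \<and> c < m"
  and Disc_trials: "Disc v \<in> trials \<longleftrightarrow> v \<in> U"
  and Kill_trials: "Kill v c \<in> trials \<longleftrightarrow> v \<in> U \<and> c < m"
  by (auto simp: trials_def)

lemmas in_trials = Pick_trials Disc_trials Kill_trials

lemma finite_trials: "finite trials"
  using finite_P finite_U by (simp add: trials_def)

lemma L_props:
  assumes "i \<in> P" "c < m" "g i c = None"
  shows "finite (L i c)" "L i c \<subseteq> U" "card (L i c) > 0" "card (L i c) \<le> n" "\<And>v. v \<in> L i c \<Longrightarrow> pt v = i"
proof -
  have *: "L i c \<subseteq> {v \<in> U. pt v = i}" using L_S[OF assms] S_U by auto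
  then show f: "finite (L i c)" "L i c \<subseteq> U" "\<And>v. v \<in> L i c \<Longrightarrow> pt v = i"
    using finite_subset[OF *] finite_U by auto
  show "card (L i c) > 0" using card_L[OF assms] a_pos by linarith
  show "card (L i c) \<le> n"
    using card_mono[OF _ *] card_part[of i] finite_U by simp
qed

lemma wP_nonneg: "0 \<le> wP i c x"
  using \<theta> by (auto simp: wP_def split: option.splits)

lemma wP_sum: assumes "i \<in> P" "c < m" shows "(\<Sum>x\<in>outcomes. wP i c x) = 1"
proof (cases "g i c = None")
  case True
  note L = L_props[OF assms True]
  have "(\<Sum>u\<in>U. if u \<in> L i c then \<theta> / card (L i c) else 0) = (\<Sum>u\<in>L i c. \<theta> / card (L i c))"
    using L finite_U by (simp add: sum.inter_restrict[symmetric] Int_absorb1)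
  also have "\<dots> = \<theta>" using L(3) by auto
  finally show ?thesis using True by (simp add: sum_outcomes wP_def)
qed (auto simp: sum_outcomes wP_def)

lemma wP_le:
  assumes "i \<in> P" "c < m"
  shows "wP i c (Some v) \<le> (if g i c = None \<and> v \<in> L i c then \<theta> / a else 0)"
  using card_L[OF assms] a_pos \<theta> by (auto simp: wP_def intro: divide_left_mono)

text \<open>At most \<open>e\<close> uncoloured pairs have \<open>v\<close> in their list, and each
  picks it with probability at most \<theta> / a. In \<open>blocked_le\<close> the same count runs
  over the available neighbours of \<open>v\<close>. Hence \<open>y\<close> is a legitimate common
  target for the coins.\<close>

lemma used_le: assumes "v \<in> U" shows "used v \<le> y"
proof -
  let ?H = "{c. c < m \<and> g (pt v) c = None \<and> v \<in> L (pt v) c}"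
  have "used v \<le> (\<Sum>c<m. if g (pt v) c = None \<and> v \<in> L (pt v) c then \<theta> / a else 0)"
    unfolding used_def using assms pt_P by (intro sum_mono wP_le) auto
  also have "\<dots> = real (card ?H) * (\<theta> / a)"
    by (simp add: sum.inter_filter[symmetric] lessThan_def)
  also have "\<dots> \<le> e * (\<theta> / a)"
    using card_H[OF assms] \<theta> a_pos by (intro mult_right_mono) auto
  finally show ?thesis by (simp add: y_def mult_ac)
qed

lemma blocked_le: assumes "v \<in> U" "c < m" shows "blocked v c \<le> y"
proof -
  have u: "u \<in> U" "pt u \<in> P" if "E v u" for u
    using that E_U2 pt_P by auto
  have "blocked v c \<le> (\<Sum>u | E v u. if u \<in> S \<and> g (pt u) c = None then \<theta> / a else 0)"
    unfolding blocked_def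
  proof (intro sum_mono)
    fix u assume "u \<in> {u. E v u}"
    then show "wP (pt u) c (Some u) \<le> (if u \<in> S \<and> g (pt u) c = None then \<theta> / a else 0)"
      using wP_le[of "pt u" c u] L_S[of "pt u" c] u[of u] assms \<theta> a_pos
      by (auto split: if_splits intro: order_trans)
  qed
  also have "\<dots> = real (card {u \<in> S. E v u \<and> g (pt u) c = None}) * (\<theta> / a)"
    using finite_nbrs by (simp add: sum.inter_filter[symmetric] conj_ac)
  also have "\<dots> \<le> e * (\<theta> / a)"
    using card_N[OF assms] \<theta> a_pos by (intro mult_right_mono) auto
  finally show ?thesis by (simp add: y_def mult_ac)
qed

lemma y_bounds: "0 \<le> y" "2 * y \<le> 1"
  using \<theta> e_pos a_pos \<theta>e by (auto simp: y_def field_simps)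

lemma coin_nonneg: "0 \<le> q \<Longrightarrow> q \<le> 1 \<Longrightarrow> 0 \<le> coin q v x"
  by (auto simp: coin_def split: option.splits)

lemma coin_sum: "v \<in> U \<Longrightarrow> (\<Sum>x\<in>outcomes. coin q v x) = 1"
  by (simp add: sum_outcomes coin_def finite_U)

lemma used_nonneg: "0 \<le> used v" and blocked_nonneg: "0 \<le> blocked v c"
  unfolding used_def blocked_def by (auto intro: sum_nonneg wP_nonneg)

sublocale fin_prod trials outcomes wt
proof
  fix t :: "'a trial" assume t: "t \<in> trials"
  show "(\<Sum>x\<in>outcomes. wt t x) = 1"
    using t by (cases t) (auto simp: wt_def wP_sum coin_sum in_trials)
  fix x assume "x \<in> outcomes"
  show "0 \<le> wt t x"
  proof (cases t)
    case (Disc v)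
    then show ?thesis using used_le[of v] used_nonneg[of v] y_bounds t
      by (auto simp: wt_def in_trials intro!: coin_nonneg)
  next
    case (Kill v c)
    then show ?thesis using blocked_le[of v c] blocked_nonneg[of v c] y_bounds t
      by (auto simp: wt_def in_trials intro!: coin_nonneg)
  qed (simp add: wt_def wP_nonneg)
qed (rule finite_trials finite_outcomes)+

section \<open>Hits, conflicts and failure events\<close>

definition kV :: "'a trial \<Rightarrow> 'a option \<Rightarrow> 'a \<Rightarrow> bool" where
  "kV t x v = (case t of Pick j c \<Rightarrow> j = pt v \<and> x = Some v | Disc u \<Rightarrow> u = v \<and> x = Some v | Kill _ _ \<Rightarrow> False)"

definition kC :: "'a trial \<Rightarrow> 'a option \<Rightarrow> 'a \<Rightarrow> nat \<Rightarrow> bool" where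
  "kC t x v c = (case t of Pick j c' \<Rightarrow> c' = c \<and> (\<exists>u. x = Some u \<and> E v u \<and> pt u = j)
     | Disc u \<Rightarrow> False | Kill u c' \<Rightarrow> u = v \<and> c' = c \<and> x = Some v)"

text \<open>A pick counts as a hit even if it is rejected afterwards. This wastes vertices, but a
  hit is then a disjunction of conditions on single independent trials.\<close>

definition hitV :: "('a trial \<Rightarrow> 'a option) \<Rightarrow> 'a \<Rightarrow> bool" where
  "hitV f v \<longleftrightarrow> (\<exists>t\<in>trials. kV t (f t) v)"

definition hitC :: "('a trial \<Rightarrow> 'a option) \<Rightarrow> 'a \<Rightarrow> nat \<Rightarrow> bool" where
  "hitC f v c \<longleftrightarrow> (\<exists>t\<in>trials. kC t (f t) v c)"

text \<open>The picks contribute \<open>used v\<close>, and the coin \<open>Disc v\<close> supplies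
  exactly the missing y - used v. In \<open>sum_kC\<close> the roles are played by
  \<open>blocked v c\<close> and \<open>Kill v c\<close>.\<close>

lemma sum_kV:
  assumes v: "v \<in> U"
  shows "(\<Sum>t\<in>trials. \<Sum>x\<in>outcomes. wt t x * of_bool (kV t x v)) = y"
proof -
  have *: "(\<Sum>u\<in>U. h u * of_bool (b \<and> u = v)) = (if b then h v else 0)" for h :: "'a \<Rightarrow> real" and b
    using v finite_U by (simp add: of_bool_def if_distrib cong: if_cong)
  have 1: "(\<Sum>x\<in>outcomes. wt (Pick i c) x * of_bool (kV (Pick i c) x v)) = (if i = pt v then wP (pt v) c (Some v) else 0)" for i c
    by (simp add: sum_outcomes kV_def wt_def *)
  have 2: "(\<Sum>x\<in>outcomes. wt (Disc u) x * of_bool (kV (Disc u) x v)) = (if u = v then y - used v else 0)" for u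
    by (simp add: sum_outcomes kV_def wt_def * coin_def)
  have "(\<Sum>i\<in>P. \<Sum>c<m. if i = pt v then wP (pt v) c (Some v) else 0) = used v"
    using pt_P[OF v] finite_P by (subst sum.swap) (simp add: used_def)
  then show ?thesis
    unfolding sum_trials 1 2 using v finite_U by (simp add: kV_def)
qed

lemma sum_kC:
  assumes v: "v \<in> U" and c: "c < m"
  shows "(\<Sum>t\<in>trials. \<Sum>x\<in>outcomes. wt t x * of_bool (kC t x v c)) = y"
proof -
  have *: "(\<Sum>u\<in>U. h u * of_bool (b \<and> u = v)) = (if b then h v else 0)" for h :: "'a \<Rightarrow> real" and b
    using v finite_U by (simp add: of_bool_def if_distrib cong: if_cong)
  have "(\<Sum>x\<in>outcomes. wt (Pick i c') x * of_bool (kC (Pick i c') x v c))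
      = (\<Sum>u\<in>U. if c' = c \<and> E v u \<and> pt u = i then wP i c' (Some u) else 0)" for i c'
    by (auto simp: sum_outcomes kC_def wt_def intro!: sum.cong)
  also have "\<dots> i c' = (if c' = c then \<Sum>u\<in>{u. E v u}. if i = pt u then wP (pt u) c (Some u) else 0 else 0)" for i c'
    using finite_U E_U2 by (auto intro!: sum.mono_neutral_cong_right split: if_splits)
  finally have 1: "(\<Sum>x\<in>outcomes. wt (Pick i c') x * of_bool (kC (Pick i c') x v c))
      = (if c' = c then \<Sum>u\<in>{u. E v u}. if i = pt u then wP (pt u) c (Some u) else 0 else 0)" for i c' .
  have 3: "(\<Sum>x\<in>outcomes. wt (Kill u c') x * of_bool (kC (Kill u c') x v c))
      = (if c' = c then if u = v then y - blocked v c else 0 else 0)" for u c'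
  proof (cases "u = v \<and> c' = c")
    case True
    then show ?thesis using *[of "\<lambda>w. coin (y - blocked v c) v (Some w)" True]
      by (simp add: sum_outcomes kC_def wt_def) (simp add: coin_def)
  qed (auto simp: kC_def)
  have "(\<Sum>i\<in>P. \<Sum>u\<in>{u. E v u}. if i = pt u then wP (pt u) c (Some u) else 0) = blocked v c"
    unfolding blocked_def using pt_P E_U2 finite_P by (subst sum.swap) (auto intro!: sum.cong)
  then show ?thesis
    unfolding sum_trials 1 3 using v c finite_U by (simp add: kC_def)
qed


text \<open>The two kinds of conflict: one vertex picked for two colours, and two adjacent vertices
  picked for one colour. The smaller colour, or the smaller part index, prevails, even if that pick
  is rejected itself. Hence the fate of a pick depends only on picks that precede it
  lexicographically.\<close>

definition early :: "('a trial \<Rightarrow> 'a option) \<Rightarrow> nat \<Rightarrow> nat \<Rightarrow> 'a \<Rightarrow> bool" where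
  "early f i c v \<longleftrightarrow> (\<exists>c'<c. f (Pick i c') = Some v) \<or> (\<exists>u. E v u \<and> pt u < i \<and> f (Pick (pt u) c) = Some u)"

definition lost :: "('a trial \<Rightarrow> 'a option) \<Rightarrow> nat \<Rightarrow> nat \<Rightarrow> 'a set" where
  "lost f i c = {v \<in> L i c. early f i c v}"

text \<open>The cap bounds the conditional probability of a risky pick, given the earlier picks, for every
  outcome; it is inactive unless \<open>badL\<close> below occurs.\<close>

definition risky :: "('a trial \<Rightarrow> 'a option) \<Rightarrow> nat \<Rightarrow> nat \<Rightarrow> 'a option set" where
  "risky f i c = (if card (lost f i c) \<le> 2 * y * card (L i c) + s then Some ` lost f i c else {})"

text \<open>\<open>\<kappa>\<close> bounds the probability that an activated pair picks from its
  capped \<open>lost\<close> set. \<open>\<sigma>\<close> bounds a survival probability: the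
  exponent adds the masses of activation and of hits, and \<theta> / a corrects for a pick of the
  vertex itself, which counts as both. \<open>\<omega>\<close> bounds the probability of a single
  failure.\<close>

definition \<kappa> :: real where "\<kappa> = 2 * y + s / a"
definition \<sigma> :: real where "\<sigma> = exp (- (\<theta> + y) + \<theta> / a)"
definition \<omega> :: real where "\<omega> = exp (- s\<^sup>2 / (4 * real C * real n))"

definition H :: "'a \<Rightarrow> nat set" where
  "H v = {c. c < m \<and> g (pt v) c = None \<and> v \<in> L (pt v) c}"

definition N :: "'a \<Rightarrow> nat \<Rightarrow> 'a set" where
  "N v c = {u \<in> S. E v u \<and> g (pt u) c = None}"

definition badL where
  "badL f i c \<longleftrightarrow> real (card {v \<in> L i c. hitV f v \<or> hitC f v c}) \<ge> 2 * y * card (L i c) + s"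
text \<open>A pair stays uncoloured because it is not activated (\<open>badH1\<close>,
  \<open>badN1\<close>) or because its pick is rejected (\<open>badH2\<close>,
  \<open>badN2\<close>). Rejections will be of second order in \<theta>, so the saving by hits is
  exploited only for the first kind.\<close>

definition badH1 where
  "badH1 f v \<longleftrightarrow> real (card {c \<in> H v. f (Pick (pt v) c) = None \<and> \<not> hitC f v c}) \<ge> e * \<sigma> + s"
definition badH2 where
  "badH2 f v \<longleftrightarrow> real (card {c \<in> H v. f (Pick (pt v) c) \<in> risky f (pt v) c}) \<ge> \<theta> * \<kappa> * e + s"
definition badN1 where
  "badN1 f v c \<longleftrightarrow> real (card {u \<in> N v c. f (Pick (pt u) c) = None \<and> \<not> hitV f u}) \<ge> e * \<sigma> + s"
definition badN2 where
  "badN2 f v c \<longleftrightarrow> real (card {u \<in> N v c. f (Pick (pt u) c) \<in> risky f (pt u) c}) \<ge> \<theta> * \<kappa> * e + s"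

text \<open>Bundling the failures by part lets the local lemma run over parts, with dependencies given by
  the distance in the graph of adjacent parts.\<close>

definition bad :: "nat \<Rightarrow> ('a trial \<Rightarrow> 'a option) \<Rightarrow> bool" where
  "bad i f \<longleftrightarrow> (\<exists>c\<in>{..<m}. g i c = None \<and> badL f i c) \<or>
     (\<exists>v\<in>{v \<in> U. pt v = i}. badH1 f v \<or> badH2 f v \<or> (\<exists>c\<in>{..<m}. badN1 f v c \<or> badN2 f v c))"

lemma finite_H: "finite (H v)" and finite_N: "finite (N v c)"
  by (auto simp: H_def N_def finite_nbrs)

lemma N_U: "u \<in> N v c \<Longrightarrow> u \<in> U \<and> pt u \<in> P \<and> E v u \<and> g (pt u) c = None"
  using S_U pt_P by (auto simp: N_def)

lemma H_props: "c \<in> H v \<Longrightarrow> c < m \<and> g (pt v) c = None \<and> v \<in> L (pt v) c"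
  by (auto simp: H_def)

lemma card_eq_sum: "finite A \<Longrightarrow> real (card {x \<in> A. Q x}) = (\<Sum>x\<in>A. of_bool (Q x))"
  by (simp add: Collect_conj_eq)

text \<open>The value l = s / (2 C n) minimises l^2 C n - l s, the exponent of the tail bound for
  mean \<open>n\<close>.\<close>

lemma \<omega>_bound:
  fixes \<mu> :: real
  assumes "\<mu> \<le> n" "0 \<le> \<mu>"
  shows "exp ((s / (2 * real C * real n))\<^sup>2 * C * \<mu> - s / (2 * real C * real n) * s) \<le> \<omega>"
proof -
  have C: "real C \<ge> 1" and n: "real n \<ge> 1" using C_pos n_pos by auto
  have "(s / (2 * real C * real n))\<^sup>2 * C * \<mu> \<le> (s / (2 * real C * real n))\<^sup>2 * C * n"
    using assms by (intro mult_left_mono) auto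
  also have "\<dots> = s\<^sup>2 / (4 * real C * real n)"
    using C n by (simp add: power2_eq_square field_simps)
  also have "\<dots> - s / (2 * real C * real n) * s = - s\<^sup>2 / (4 * real C * real n)"
    using C n by (simp add: power2_eq_square field_simps)
  finally show ?thesis by (simp add: \<omega>_def)
qed

lemma l_bounds: "0 \<le> s / (2 * real C * n)" "s / (2 * real C * n) * C \<le> 1" "0 \<le> real C"
proof -
  have C: "real C \<ge> 1" and n: "real n \<ge> 1" using C_pos n_pos by auto
  then show "0 \<le> s / (2 * real C * n)" "0 \<le> real C" using s by auto
  have "s / (2 * real C * n) * C = s / (2 * n)" using C by simp
  also have "\<dots> \<le> 1" using s n by simp
  finally show "s / (2 * real C * n) * C \<le> 1" .
qed

lemma indep_tail:
  assumes "finite G" "\<And>x. x \<in> G \<Longrightarrow> depends (Y x) (D x)" "\<And>x. x \<in> G \<Longrightarrow> D x \<subseteq> trials"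
    "disjoint_family_on D G" "\<And>x f. x \<in> G \<Longrightarrow> f \<in> supp \<Longrightarrow> 0 \<le> Y x f \<and> Y x f \<le> real C"
    "(\<Sum>x\<in>G. Ex (Y x)) \<le> \<mu>" "0 \<le> \<mu>" "\<mu> \<le> n"
  shows "Pr (\<lambda>f. (\<Sum>x\<in>G. Y x f) \<ge> \<mu> + s) \<le> \<omega>"
  by (rule order_trans[OF chernoff_indep[OF assms(1-6) l_bounds] \<omega>_bound[OF assms(8,7)]])

section \<open>Failure probabilities\<close>

lemma supp_Pick:
  assumes "f \<in> supp" "i \<in> P" "c < m"
  shows "f (Pick i c) = Some v \<Longrightarrow> g i c = None \<and> v \<in> L i c"
proof -
  assume "f (Pick i c) = Some v"
  moreover have "wt (Pick i c) (f (Pick i c)) > 0"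
    using suppD[OF assms(1), of "Pick i c"] assms by (auto simp: in_trials)
  ultimately show ?thesis by (auto simp: wt_def wP_def split: if_splits)
qed

text \<open>The number of removed list vertices is at most a sum of contributions of single trials.
  Each contribution is at most \<open>C\<close>: a coin or a pick in part \<open>i\<close> removes
  at most one vertex, and a pick \<open>u\<close> elsewhere only neighbours of \<open>u\<close> in
  part \<open>i\<close>. After exchanging sums, each list vertex receives mass \<open>y\<close> from
  \<open>sum_kV\<close> and \<open>y\<close> from \<open>sum_kC\<close>.\<close>

lemma Pr_badL:
  assumes i: "i \<in> P" and c: "c < m" and gic: "g i c = None"
  shows "Pr (\<lambda>f. badL f i c) \<le> \<omega>"
proof -
  note Lp = L_props[OF i c gic]
  define z where "z t x = real (card {v \<in> L i c. kV t x v \<or> kC t x v c})" for t x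
  have "Pr (\<lambda>f. badL f i c) \<le> Pr (\<lambda>f. (\<Sum>t\<in>trials. z t (f t)) \<ge> 2 * y * card (L i c) + s)"
  proof (rule Pr_mono)
    fix f assume "badL f i c"
    have "{v \<in> L i c. hitV f v \<or> hitC f v c} \<subseteq> (\<Union>t\<in>trials. {v \<in> L i c. kV t (f t) v \<or> kC t (f t) v c})"
      by (auto simp: hitV_def hitC_def)
    then have "card {v \<in> L i c. hitV f v \<or> hitC f v c} \<le> card (\<Union>t\<in>trials. {v \<in> L i c. kV t (f t) v \<or> kC t (f t) v c})"
      using Lp finite_trials by (intro card_mono) auto
    also have "\<dots> \<le> (\<Sum>t\<in>trials. card {v \<in> L i c. kV t (f t) v \<or> kC t (f t) v c})"
      by (rule card_UN_le[OF finite_trials])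
    finally have "real (card {v \<in> L i c. hitV f v \<or> hitC f v c}) \<le> (\<Sum>t\<in>trials. z t (f t))"
      unfolding z_def of_nat_sum[symmetric] of_nat_le_iff .
    then show "(\<Sum>t\<in>trials. z t (f t)) \<ge> 2 * y * card (L i c) + s"
      using \<open>badL f i c\<close> unfolding badL_def by linarith
  qed
  also have "\<dots> \<le> \<omega>"
  proof (rule indep_tail[where D = "\<lambda>t. {t}"])
    fix t f assume t: "t \<in> trials" and f: "f \<in> supp"
    have "card {v \<in> L i c. kV t (f t) v \<or> kC t (f t) v c} \<le> C"
    proof -
      have one: "card B \<le> C" if "B \<subseteq> {v}" for B and v :: 'a
        using card_mono[OF _ that] C_pos by simp
      show ?thesis
      proof (cases t)
        case (Pick j c')
        show ?thesis
        proof (cases "f t")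
          case (Some u)
          have jc: "j \<in> P" "c' < m" using t Pick by (auto simp: in_trials)
          have uj: "pt u = j"
            using supp_Pick[OF f jc, of u] L_props(5)[OF jc, of u] Pick Some by simp
          show ?thesis
          proof (cases "j = i")
            case True
            have "\<not> E v u" if "v \<in> L i c" for v using E_pt[of v u] Lp(5)[OF that] uj True by auto
            then show ?thesis using Pick Some
              by (intro one[of _ u]) (auto simp: kV_def kC_def)
          next
            case False
            have "{v \<in> L i c. kV t (f t) v \<or> kC t (f t) v c} \<subseteq> {v. E u v \<and> pt v = i}"
              using False Lp(5) E_sym Pick Some by (auto simp: kV_def kC_def)
            then have "card {v \<in> L i c. kV t (f t) v \<or> kC t (f t) v c} \<le> card {v. E u v \<and> pt v = i}"
              by (rule card_mono[OF finite_nbrs(2)])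
            then show ?thesis using local_deg[of u i] by linarith
          qed
        qed (use Pick in \<open>simp add: kV_def kC_def\<close>)
      next
        case (Disc u)
        then show ?thesis by (intro one[of _ u]) (auto simp: kV_def kC_def)
      next
        case (Kill u c')
        then show ?thesis by (intro one[of _ u]) (auto simp: kV_def kC_def)
      qed
    qed
    then show "0 \<le> z t (f t) \<and> z t (f t) \<le> real C" by (simp add: z_def)
  next
    have "(\<Sum>t\<in>trials. Ex (\<lambda>f. z t (f t))) = (\<Sum>t\<in>trials. \<Sum>x\<in>outcomes. wt t x * z t x)"
      by (intro sum.cong Ex_single) auto
    also have "\<dots> \<le> (\<Sum>t\<in>trials. \<Sum>x\<in>outcomes. wt t x * (\<Sum>v\<in>L i c. of_bool (kV t x v) + of_bool (kC t x v c)))"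
    proof (intro sum_mono mult_left_mono)
      fix t x
      have "z t x = (\<Sum>v\<in>L i c. of_bool (kV t x v \<or> kC t x v c))"
        unfolding z_def by (rule card_eq_sum[OF Lp(1)])
      also have "\<dots> \<le> (\<Sum>v\<in>L i c. of_bool (kV t x v) + of_bool (kC t x v c))"
        by (intro sum_mono) auto
      finally show "z t x \<le> (\<Sum>v\<in>L i c. of_bool (kV t x v) + of_bool (kC t x v c))" .
    qed (auto intro: w_nonneg)
    also have "\<dots> = (\<Sum>t\<in>trials. \<Sum>v\<in>L i c. \<Sum>x\<in>outcomes. wt t x * of_bool (kV t x v) + wt t x * of_bool (kC t x v c))"
      unfolding sum_distrib_left distrib_left by (rule sum.cong[OF refl], rule sum.swap)
    also have "\<dots> = (\<Sum>v\<in>L i c. \<Sum>t\<in>trials. \<Sum>x\<in>outcomes. wt t x * of_bool (kV t x v) + wt t x * of_bool (kC t x v c))"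
      by (rule sum.swap)
    also have "\<dots> = (\<Sum>v\<in>L i c. y + y)"
    proof (rule sum.cong[OF refl])
      fix v assume "v \<in> L i c"
      then have "v \<in> U" using Lp by auto
      then show "(\<Sum>t\<in>trials. \<Sum>x\<in>outcomes. wt t x * of_bool (kV t x v) + wt t x * of_bool (kC t x v c)) = y + y"
        by (simp only: sum.distrib sum_kV sum_kC c)
    qed
    finally show "(\<Sum>t\<in>trials. Ex (\<lambda>f. z t (f t))) \<le> 2 * y * card (L i c)"
      by (simp add: mult_ac)
  next
    have "2 * y * card (L i c) \<le> 1 * real (card (L i c))" using y_bounds by (intro mult_right_mono) auto
    then show "2 * y * card (L i c) \<le> n" using Lp(4) by linarith
  qed (use y_bounds finite_trials in \<open>auto simp: depends_def disjoint_family_on_def\<close>)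
  finally show ?thesis .
qed

lemma \<theta>_outcomes:
  assumes "i \<in> P" "c < m" "g i c = None"
  shows "(\<Sum>x\<in>outcomes. wP i c x * of_bool (x \<noteq> None)) = \<theta>"
proof -
  have "(\<Sum>x\<in>outcomes. wP i c x * of_bool (x \<noteq> None)) = (\<Sum>x\<in>outcomes. wP i c x) - wP i c None"
    by (simp add: sum_outcomes)
  then show ?thesis using wP_sum[OF assms(1,2)] assms(3) by (simp add: wP_def[of _ _ None])
qed

text \<open>The event forbids every trial to strike \<open>v\<close> for colour \<open>c\<close> and
  the trial of the pair itself to be active. That trial cannot strike, as no neighbour of
  \<open>v\<close> lies in the part of \<open>v\<close>, so the masses \<open>y\<close> and \<theta>
  add up exactly.\<close>

lemma Pr_survive_colour:
  assumes v: "v \<in> U" and c: "c \<in> H v"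
  shows "Pr (\<lambda>f. f (Pick (pt v) c) = None \<and> \<not> hitC f v c) \<le> exp (- (\<theta> + y))"
proof -
  define K where "K t = {x. kC t x v c \<or> t = Pick (pt v) c \<and> x \<noteq> None}" for t
  have cm: "c < m" "g (pt v) c = None" using H_props[OF c] by auto
  have "(\<Sum>x\<in>outcomes \<inter> K t. wt t x) = (\<Sum>x\<in>outcomes. wt t x * of_bool (kC t x v c))
      + (if t = Pick (pt v) c then \<theta> else 0)" if "t \<in> trials" for t
  proof (cases "t = Pick (pt v) c")
    case True
    have no: "\<not> kC t x v c" for x using True E_pt[of v] by (fastforce simp: kC_def)
    have "(\<Sum>x\<in>outcomes \<inter> K t. wt t x) = (\<Sum>x\<in>outcomes. wP (pt v) c x * of_bool (x \<noteq> None))"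
      unfolding sum_of_bool_inter[symmetric] using no
      by (intro sum.cong) (auto simp: K_def True wt_def)
    then show ?thesis using \<theta>_outcomes[OF pt_P[OF v] cm] True no by simp
  next
    case False
    then show ?thesis unfolding sum_of_bool_inter[symmetric] by (auto simp: K_def intro!: sum.cong)
  qed
  then have "(\<Sum>t\<in>trials. \<Sum>x\<in>outcomes \<inter> K t. wt t x) = y + \<theta>"
    using sum_kC[OF v cm(1)] pt_P[OF v] cm finite_trials by (simp add: sum.distrib in_trials)
  then have "Pr (\<lambda>f. \<forall>t\<in>trials. f t \<notin> K t) \<le> exp (- (\<theta> + y))"
    using Pr_avoid_le[OF subset_refl, of K] by (simp add: add.commute)
  moreover have "Pr (\<lambda>f. f (Pick (pt v) c) = None \<and> \<not> hitC f v c) \<le> Pr (\<lambda>f. \<forall>t\<in>trials. f t \<notin> K t)"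
    by (rule Pr_mono) (auto simp: K_def hitC_def)
  ultimately show ?thesis by linarith
qed

text \<open>Here the pick of the pair may be \<open>u\<close> itself, a value counted both as a hit
  and as an activation; its probability is at most \<theta> / a, which is subtracted from the total
  mass.\<close>

lemma Pr_survive_vertex:
  assumes u: "u \<in> U" and c: "c < m" and guc: "g (pt u) c = None"
  shows "Pr (\<lambda>f. f (Pick (pt u) c) = None \<and> \<not> hitV f u) \<le> \<sigma>"
proof -
  define K where "K t = {x. kV t x u \<or> t = Pick (pt u) c \<and> x \<noteq> None}" for t
  have "(\<Sum>x\<in>outcomes. wt t x * of_bool (kV t x u)) + (if t = Pick (pt u) c then \<theta> - \<theta> / a else 0)
      \<le> (\<Sum>x\<in>outcomes \<inter> K t. wt t x)" if "t \<in> trials" for t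
  proof (cases "t = Pick (pt u) c")
    case True
    have "(\<Sum>x\<in>outcomes \<inter> K t. wt t x) = (\<Sum>x\<in>outcomes. wP (pt u) c x * of_bool (x \<noteq> None))"
      unfolding sum_of_bool_inter[symmetric] by (auto simp: K_def True wt_def kV_def intro!: sum.cong)
    also have "\<dots> = \<theta>" by (rule \<theta>_outcomes[OF pt_P[OF u] c guc])
    finally have 1: "(\<Sum>x\<in>outcomes \<inter> K t. wt t x) = \<theta>" .
    have "(\<Sum>x\<in>outcomes. wt t x * of_bool (kV t x u)) = (\<Sum>x\<in>{Some u}. wt t x)"
      unfolding True using u finite_outcomes by (intro sum.mono_neutral_cong_right) (auto simp: kV_def outcomes_def)
    also have "\<dots> \<le> \<theta> / a"
      using wP_le[OF pt_P[OF u] c, of u] \<theta> a_pos by (auto simp: True wt_def split: if_splits intro: order_trans)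
    finally show ?thesis using 1 True by simp
  next
    case False
    then show ?thesis unfolding sum_of_bool_inter[symmetric] by (auto simp: K_def intro!: sum_mono)
  qed
  then have "(\<Sum>t\<in>trials. (\<Sum>x\<in>outcomes. wt t x * of_bool (kV t x u)) + (if t = Pick (pt u) c then \<theta> - \<theta> / a else 0))
      \<le> (\<Sum>t\<in>trials. \<Sum>x\<in>outcomes \<inter> K t. wt t x)"
    by (rule sum_mono)
  then have "y + (\<theta> - \<theta> / a) \<le> (\<Sum>t\<in>trials. \<Sum>x\<in>outcomes \<inter> K t. wt t x)"
    using sum_kV[OF u] pt_P[OF u] c finite_trials by (simp add: sum.distrib in_trials)
  then have "Pr (\<lambda>f. \<forall>t\<in>trials. f t \<notin> K t) \<le> \<sigma>"
    using Pr_avoid_le[OF subset_refl, of K] by (auto simp: \<sigma>_def intro: order_trans)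
  moreover have "Pr (\<lambda>f. f (Pick (pt u) c) = None \<and> \<not> hitV f u) \<le> Pr (\<lambda>f. \<forall>t\<in>trials. f t \<notin> K t)"
    by (rule Pr_mono) (auto simp: K_def hitV_def)
  ultimately show ?thesis by linarith
qed

text \<open>Trials are sorted by colour and by part into independent blocks: each term of
  \<open>badH1\<close> reads trials of one colour, and the terms of \<open>badN1\<close> that belong
  to one part read trials of that part. \<open>Disc v\<close> gets no colour because
  \<open>kC\<close> never holds for it.\<close>

fun tcol :: "'a trial \<Rightarrow> nat option" where
  "tcol (Pick i c) = Some c" | "tcol (Disc v) = None" | "tcol (Kill v c) = Some c"

fun tpart :: "'a trial \<Rightarrow> nat" where
  "tpart (Pick i c) = i" | "tpart (Disc v) = pt v" | "tpart (Kill v c) = pt v"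

lemma hitV_cong:
  assumes "\<And>t. t \<in> trials \<Longrightarrow> tpart t = pt v \<Longrightarrow> f t = f' t"
  shows "hitV f v = hitV f' v"
proof -
  have "kV t (f t) v = kV t (f' t) v" if "t \<in> trials" for t
    using assms[OF that] by (cases "tpart t = pt v"; cases t) (auto simp: kV_def)
  then show ?thesis by (simp add: hitV_def)
qed

lemma hitC_cong_col:
  assumes "\<And>t. t \<in> trials \<Longrightarrow> tcol t = Some c \<Longrightarrow> f t = f' t"
  shows "hitC f v c = hitC f' v c"
proof -
  have "kC t (f t) v c = kC t (f' t) v c" if "t \<in> trials" for t
    using assms[OF that] by (cases "tcol t = Some c"; cases t) (auto simp: kC_def)
  then show ?thesis by (simp add: hitC_def)
qed

lemma hitC_cong:
  assumes "\<And>t. t \<in> trials \<Longrightarrow> tpart t \<in> ball1 (pt v) \<Longrightarrow> f t = f' t"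
  shows "hitC f v c = hitC f' v c"
proof -
  have "kC t (f t) v c = kC t (f' t) v c" if "t \<in> trials" for t
    using assms[OF that] ball1_nbr[of v] ball1_self[of "pt v"]
    by (cases "tpart t \<in> ball1 (pt v)"; cases t) (auto simp: kC_def)
  then show ?thesis by (simp add: hitC_def)
qed

lemma e\<sigma>_le: "\<theta> \<le> a * \<theta> \<Longrightarrow> 0 \<le> e * \<sigma> \<and> e * \<sigma> \<le> n"
proof -
  assume "\<theta> \<le> a * \<theta>"
  then have "\<theta> / a \<le> \<theta>" using a_pos by (simp add: field_simps)
  then have "\<sigma> \<le> 1" using y_bounds by (simp add: \<sigma>_def)
  then have "e * \<sigma> \<le> e * 1" using e_pos by (intro mult_left_mono) auto
  then show ?thesis using e_le e_pos by (auto simp: \<sigma>_def)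
qed

lemma Pr_badH1:
  assumes v: "v \<in> U" and a1: "a \<ge> 1"
  shows "Pr (\<lambda>f. badH1 f v) \<le> \<omega>"
proof -
  have a\<theta>: "\<theta> \<le> a * \<theta>" using a1 \<theta> by simp
  have "Pr (\<lambda>f. badH1 f v)
      = Pr (\<lambda>f. (\<Sum>c\<in>H v. of_bool (f (Pick (pt v) c) = None \<and> \<not> hitC f v c)) \<ge> e * \<sigma> + s)"
    by (simp only: badH1_def card_eq_sum[OF finite_H])
  also have "\<dots> \<le> \<omega>"
  proof (rule indep_tail[where D = "\<lambda>c. {t \<in> trials. tcol t = Some c}"])
    fix c assume c: "c \<in> H v"
    show "depends (\<lambda>f. of_bool (f (Pick (pt v) c) = None \<and> \<not> hitC f v c) :: real) {t \<in> trials. tcol t = Some c}"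
    proof (rule dependsI)
      fix f f' :: "'a trial \<Rightarrow> 'a option" assume ff: "\<And>t. t \<in> {t \<in> trials. tcol t = Some c} \<Longrightarrow> f t = f' t"
      have "f (Pick (pt v) c) = f' (Pick (pt v) c)"
        using H_props[OF c] pt_P[OF v] by (intro ff) (auto simp: in_trials)
      moreover have "hitC f v c = hitC f' v c" using ff by (intro hitC_cong_col) auto
      ultimately show "of_bool (f (Pick (pt v) c) = None \<and> \<not> hitC f v c)
          = (of_bool (f' (Pick (pt v) c) = None \<and> \<not> hitC f' v c) :: real)" by simp
    qed
  next
    have "exp (- (\<theta> + y)) \<le> \<sigma>" using \<theta> a_pos by (simp add: \<sigma>_def)
    then have "(\<Sum>c\<in>H v. Pr (\<lambda>f. f (Pick (pt v) c) = None \<and> \<not> hitC f v c)) \<le> (\<Sum>c\<in>H v. \<sigma>)"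
      using Pr_survive_colour[OF v] by (intro sum_mono) (auto intro: order_trans)
    also have "\<dots> \<le> e * \<sigma>"
      using card_H[OF v] by (auto simp: H_def \<sigma>_def intro!: mult_right_mono)
    finally show "(\<Sum>c\<in>H v. Pr (\<lambda>f. f (Pick (pt v) c) = None \<and> \<not> hitC f v c)) \<le> e * \<sigma>" .
  qed (use e\<sigma>_le[OF a\<theta>] C_pos finite_H in \<open>auto simp: disjoint_family_on_def of_bool_def\<close>)
  finally show ?thesis .
qed

text \<open>Vertices of the same part share trials, so they are grouped. By the local degree bound a
  group contains at most \<open>C\<close> neighbours of \<open>v\<close>, the range allowed for one
  independent summand.\<close>

lemma Pr_badN1:
  assumes v: "v \<in> U" and c: "c < m" and a1: "a \<ge> 1"
  shows "Pr (\<lambda>f. badN1 f v c) \<le> \<omega>"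
proof -
  have a\<theta>: "\<theta> \<le> a * \<theta>" using a1 \<theta> by simp
  define Q where "Q u f = (f (Pick (pt u) c) = None \<and> \<not> hitV f u)" for u f
  define Nj where "Nj j = {u \<in> N v c. pt u = j}" for j
  have fN: "finite (Nj j)" for j using finite_N by (simp add: Nj_def)
  have sumN: "(\<Sum>u\<in>N v c. h u) = (\<Sum>j\<in>P. \<Sum>u\<in>Nj j. h u)" for h :: "'a \<Rightarrow> real"
    unfolding Nj_def using N_U by (intro sum.group[symmetric]) (auto simp: finite_N finite_P)
  have "badN1 f v c \<longleftrightarrow> (\<Sum>j\<in>P. \<Sum>u\<in>Nj j. of_bool (Q u f)) \<ge> e * \<sigma> + s" for f
    unfolding sumN[symmetric] by (simp only: badN1_def card_eq_sum[OF finite_N] Q_def)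
  then have "Pr (\<lambda>f. badN1 f v c) = Pr (\<lambda>f. (\<Sum>j\<in>P. \<Sum>u\<in>Nj j. of_bool (Q u f)) \<ge> e * \<sigma> + s)"
    by simp
  also have "\<dots> \<le> \<omega>"
  proof (rule indep_tail[where D = "\<lambda>j. {t \<in> trials. tpart t = j}"])
    fix j assume j: "j \<in> P"
    show "depends (\<lambda>f. \<Sum>u\<in>Nj j. of_bool (Q u f) :: real) {t \<in> trials. tpart t = j}"
    proof (rule dependsI, rule sum.cong[OF refl])
      fix f f' :: "'a trial \<Rightarrow> 'a option" and u
      assume ff: "\<And>t. t \<in> {t \<in> trials. tpart t = j} \<Longrightarrow> f t = f' t" and u: "u \<in> Nj j"
      have "f (Pick (pt u) c) = f' (Pick (pt u) c)"
        using u c j by (intro ff) (auto simp: in_trials Nj_def)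
      moreover have "hitV f u = hitV f' u" using ff u by (intro hitV_cong) (auto simp: Nj_def)
      ultimately show "of_bool (Q u f) = (of_bool (Q u f') :: real)" by (simp add: Q_def)
    qed
    have "card (Nj j) \<le> card {u. E v u \<and> pt u = j}"
      by (rule card_mono[OF finite_nbrs(2)]) (auto simp: Nj_def N_def)
    then have "card (Nj j) \<le> C" using local_deg[of v j] by linarith
    moreover fix f
    have "(\<Sum>u\<in>Nj j. of_bool (Q u f) :: real) \<le> (\<Sum>u\<in>Nj j. 1)" by (intro sum_mono) auto
    ultimately show "0 \<le> (\<Sum>u\<in>Nj j. of_bool (Q u f) :: real) \<and> (\<Sum>u\<in>Nj j. of_bool (Q u f)) \<le> real C"
      by (auto intro: sum_nonneg)
  next
    have "(\<Sum>j\<in>P. Ex (\<lambda>f. \<Sum>u\<in>Nj j. of_bool (Q u f))) = (\<Sum>u\<in>N v c. Pr (Q u))"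
      unfolding Ex_sum sumN ..
    also have "\<dots> \<le> (\<Sum>u\<in>N v c. \<sigma>)"
      unfolding Q_def using Pr_survive_vertex[OF _ c] N_U by (intro sum_mono) blast
    also have "\<dots> \<le> e * \<sigma>"
      using card_N[OF v c] by (auto simp: N_def \<sigma>_def intro!: mult_right_mono)
    finally show "(\<Sum>j\<in>P. Ex (\<lambda>f. \<Sum>u\<in>Nj j. of_bool (Q u f))) \<le> e * \<sigma>" .
  qed (use e\<sigma>_le[OF a\<theta>] finite_P in \<open>auto simp: disjoint_family_on_def\<close>)
  finally show ?thesis .
qed

section \<open>Rejected picks, examined in lexicographic order\<close>

lemma lost_cong:
  assumes "i \<in> P" "c < m" "\<And>c'. c' < c \<Longrightarrow> f (Pick i c') = f' (Pick i c')"
    "\<And>j. j < i \<Longrightarrow> j \<in> P \<Longrightarrow> j \<in> ball1 i \<Longrightarrow> f (Pick j c) = f' (Pick j c)" "g i c = None"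
  shows "lost f i c = lost f' i c"
proof -
  have "early f i c v = early f' i c v" if v: "v \<in> L i c" for v
  proof -
    have "f (Pick (pt u) c) = f' (Pick (pt u) c)" if "E v u" "pt u < i" for u
      using that ball1_nbr[OF that(1)] E_U2 pt_P L_props(5)[OF assms(1,2,5) v] by (intro assms(4)) auto
    then show ?thesis using assms(3) unfolding early_def by auto
  qed
  then show ?thesis unfolding lost_def by auto
qed

text \<open>Lexicographic rank by part, then colour, injective on the pairs with c < m. As
  \<open>lost\<close> reads no coins, 0 can serve as their rank.\<close>

fun trank :: "'a trial \<Rightarrow> nat" where
  "trank (Pick i c) = i * m + c" | "trank _ = 0"

text \<open>Transports a function of pairs to trials, the index type of
  \<open>chernoff_seq\<close>.\<close>

fun tgen :: "(nat \<Rightarrow> nat \<Rightarrow> 'b) \<Rightarrow> 'b \<Rightarrow> 'a trial \<Rightarrow> 'b" where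
  "tgen h d (Pick i c) = h i c" | "tgen h d _ = d"

lemma \<kappa>_bounds: "0 \<le> \<kappa>"
  using y_bounds s a_pos by (simp add: \<kappa>_def)

text \<open>Risky picks are not independent, since \<open>lost\<close> depends on other picks. But
  the trials of smaller rank determine \<open>lost f i c\<close>, and thanks to the cap the pick
  then falls into it with probability at most \<theta> \<kappa>, which is what
  \<open>chernoff_seq\<close> asks for.\<close>

lemma risky_tail:
  assumes R: "R \<subseteq> P \<times> {..<m}" and RN: "\<And>i c. (i, c) \<in> R \<Longrightarrow> g i c = None"
    and h: "\<And>i c. (i, c) \<in> R \<Longrightarrow> 0 \<le> h i c \<and> h i c \<le> real C"
    and hsum: "(\<Sum>(i, c)\<in>R. h i c) \<le> e" and \<kappa>1: "\<kappa> \<le> 1"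
  shows "Pr (\<lambda>f. (\<Sum>(i, c)\<in>R. h i c * of_bool (f (Pick i c) \<in> risky f i c)) \<ge> \<theta> * \<kappa> * e + s) \<le> \<omega>"
proof -
  define T where "T = (\<lambda>(i, c). Pick i c :: 'a trial) ` R"
  have sumT: "(\<Sum>t\<in>T. q t) = (\<Sum>(i, c)\<in>R. q (Pick i c))" for q :: "'a trial \<Rightarrow> real"
    unfolding T_def by (subst sum.reindex) (auto simp: inj_on_def intro!: sum.cong)
  have Tin: "\<And>t. t \<in> T \<Longrightarrow> \<exists>i c. t = Pick i c \<and> (i, c) \<in> R \<and> i \<in> P \<and> c < m \<and> g i c = None"
    using R RN by (auto simp: T_def)
  have "Pr (\<lambda>f. (\<Sum>t\<in>T. tgen h 0 t * of_bool (f t \<in> tgen (risky f) {} t)) \<ge> \<theta> * \<kappa> * e + s)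
      \<le> exp ((s / (2 * real C * real n))\<^sup>2 * C * (\<theta> * \<kappa> * e) - s / (2 * real C * real n) * s)"
  proof (rule chernoff_seq[where rank = trank and P = "\<lambda>t. {u. trank u < trank t}" and \<pi> = "\<theta> * \<kappa>", OF _ _ _ _ _ _ _ l_bounds])
    show "T \<subseteq> trials" using Tin by (force simp: in_trials)
    show "inj_on trank T"
    proof (rule inj_onI)
      fix t u assume tu: "t \<in> T" "u \<in> T" "trank t = trank u"
      obtain i c j d where *: "t = Pick i c" "u = Pick j d" "c < m" "d < m" using Tin tu by metis
      have "i * m + c = j * m + d" using tu * by simp
      then have "(i * m + c) div m = (j * m + d) div m" "(i * m + c) mod m = (j * m + d) mod m" by auto
      then show "t = u" using * by simp
    qed
    fix t assume "t \<in> T"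
    then obtain i c where t: "t = Pick i c" "(i, c) \<in> R" "i \<in> P" "c < m" "g i c = None" using Tin by metis
    show "0 \<le> tgen h 0 t \<and> tgen h 0 t \<le> real C" using h t by auto
    show "depends (\<lambda>f. tgen (risky f) {} t) {u. trank u < trank t}"
    proof (rule dependsI)
      fix f f' :: "'a trial \<Rightarrow> 'a option" assume ff: "\<And>u. u \<in> {u. trank u < trank t} \<Longrightarrow> f u = f' u"
      have "lost f i c = lost f' i c"
      proof (rule lost_cong[OF t(3,4)])
        fix j assume "j < i"
        then have "j * m < i * m" using t(4) by simp
        then show "f (Pick j c) = f' (Pick j c)" using t by (intro ff) simp
      qed (use ff t in auto)
      then show "tgen (risky f) {} t = tgen (risky f') {} t" by (simp add: t risky_def)
    qed
    fix f
    note Lp = L_props[OF t(3-5)]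
    show "(\<Sum>x\<in>outcomes \<inter> tgen (risky f) {} t. wt t x) \<le> \<theta> * \<kappa>"
    proof (cases "card (lost f i c) \<le> 2 * y * card (L i c) + s")
      case True
      have sub: "lost f i c \<subseteq> L i c" by (auto simp: lost_def)
      then have "(\<Sum>x\<in>outcomes \<inter> tgen (risky f) {} t. wt t x) = (\<Sum>x\<in>Some ` lost f i c. wP i c x)"
        using True Lp(2) by (intro sum.cong) (auto simp: t risky_def outcomes_def wt_def)
      also have "\<dots> = (\<Sum>v\<in>lost f i c. \<theta> / card (L i c))"
        using sub t by (subst sum.reindex, simp, intro sum.cong) (auto simp: wP_def)
      also have "\<dots> = \<theta> * (card (lost f i c) / card (L i c))" by (simp add: mult.commute)
      also have "\<dots> \<le> \<theta> * ((2 * y * card (L i c) + s) / card (L i c))"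
        using True \<theta> by (intro mult_left_mono divide_right_mono) auto
      also have "(2 * y * card (L i c) + s) / card (L i c) = 2 * y + s / card (L i c)"
        using Lp(3) by (simp add: add_divide_distrib)
      also have "\<theta> * \<dots> \<le> \<theta> * \<kappa>"
        unfolding \<kappa>_def using card_L[OF t(3-5)] a_pos s \<theta>
        by (intro mult_left_mono add_left_mono divide_left_mono) auto
      finally show ?thesis .
    next
      case False
      then show ?thesis using \<kappa>_bounds \<theta> by (simp add: t risky_def)
    qed
  next
    show "\<theta> * \<kappa> * (\<Sum>t\<in>T. tgen h 0 t) \<le> \<theta> * \<kappa> * e"
      using hsum \<kappa>_bounds \<theta> by (intro mult_left_mono) (auto simp: sumT case_prod_unfold)
  qed auto
  also have "\<dots> \<le> \<omega>"
  proof (rule \<omega>_bound)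
    have "\<theta> * \<kappa> * e \<le> 1 * 1 * e"
      using \<theta> \<kappa>1 \<kappa>_bounds e_pos by (intro mult_right_mono mult_mono) auto
    then show "\<theta> * \<kappa> * e \<le> n" using e_le by simp
    show "0 \<le> \<theta> * \<kappa> * e" using \<theta> \<kappa>_bounds e_pos by simp
  qed
  finally show ?thesis by (simp add: sumT case_prod_unfold)
qed

lemma Pr_badH2:
  assumes v: "v \<in> U" and \<kappa>1: "\<kappa> \<le> 1"
  shows "Pr (\<lambda>f. badH2 f v) \<le> \<omega>"
proof -
  have sumR: "(\<Sum>(i, c)\<in>{pt v} \<times> H v. q i c) = (\<Sum>c\<in>H v. q (pt v) c)" for q :: "nat \<Rightarrow> nat \<Rightarrow> real"
    by (simp add: sum.cartesian_product[symmetric])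
  have "Pr (\<lambda>f. (\<Sum>(i, c)\<in>{pt v} \<times> H v. 1 * of_bool (f (Pick i c) \<in> risky f i c)) \<ge> \<theta> * \<kappa> * e + s) \<le> \<omega>"
  proof (rule risky_tail[OF _ _ _ _ \<kappa>1])
    show "(\<Sum>(i, c)\<in>{pt v} \<times> H v. 1) \<le> e" unfolding sumR using card_H[OF v] by (simp add: H_def)
  qed (use pt_P[OF v] C_pos in \<open>auto simp: H_def\<close>)
  then show ?thesis unfolding sumR by (simp only: badH2_def card_eq_sum[OF finite_H] mult_1)
qed

text \<open>Whether a neighbour of \<open>v\<close> in part \<open>i\<close> is counted is decided
  by \<open>Pick i c\<close> and its risky set, the same for all of them. They are therefore merged
  into one term of weight \<open>h i\<close>, which is at most \<open>C\<close>.\<close>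

lemma Pr_badN2:
  assumes v: "v \<in> U" and c: "c < m" and \<kappa>1: "\<kappa> \<le> 1"
  shows "Pr (\<lambda>f. badN2 f v c) \<le> \<omega>"
proof -
  define M where "M = pt ` N v c"
  define h where "h j = card {u \<in> N v c. pt u = j}" for j
  have M: "finite M" by (simp add: M_def finite_N)
  have sumN: "(\<Sum>u\<in>N v c. q (pt u)) = (\<Sum>j\<in>M. real (h j) * q j)" for q :: "nat \<Rightarrow> real"
    unfolding M_def by (subst sum.image_gen[OF finite_N, of _ _ _ pt]) (auto simp: h_def intro!: sum.cong)
  have sumR: "(\<Sum>(i, c)\<in>M \<times> {c}. q i c) = (\<Sum>i\<in>M. q i c)" for q :: "nat \<Rightarrow> nat \<Rightarrow> real"
    by (simp add: sum.cartesian_product[symmetric])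
  have "Pr (\<lambda>f. (\<Sum>(i, c)\<in>M \<times> {c}. real (h i) * of_bool (f (Pick i c) \<in> risky f i c)) \<ge> \<theta> * \<kappa> * e + s) \<le> \<omega>"
  proof (rule risky_tail[OF _ _ _ _ \<kappa>1])
    show "(\<Sum>(i, c)\<in>M \<times> {c}. real (h i)) \<le> e"
      unfolding sumR using card_N[OF v c] sumN[of "\<lambda>_. 1"] by (simp add: N_def)
    fix i c' assume "(i, c') \<in> M \<times> {c}"
    have "h i \<le> card {u. E v u \<and> pt u = i}"
      unfolding h_def by (rule card_mono[OF finite_nbrs(2)]) (auto simp: N_def)
    then show "0 \<le> real (h i) \<and> real (h i) \<le> real C" using local_deg[of v i] by simp
  qed (use N_U c in \<open>auto simp: M_def\<close>)
  then show ?thesis unfolding sumR sumN[symmetric] by (simp only: badN2_def card_eq_sum[OF finite_N])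
qed


section \<open>Avoiding all failures at once\<close>

lemma Pr_bad:
  assumes i: "i \<in> P" and a1: "a \<ge> 1" and \<kappa>1: "\<kappa> \<le> 1"
  shows "Pr (bad i) \<le> 5 * n\<^sup>2 * \<omega>"
proof -
  let ?W = "{v \<in> U. pt v = i}"
  have \<omega>: "\<omega> \<ge> 0" by (simp add: \<omega>_def)
  have union: "Pr (\<lambda>f. A f \<or> B f) \<le> Pr A + Pr B" for A B
    unfolding Ex_add[symmetric] by (rule Ex_mono) auto
  have colours: "Pr (\<lambda>f. \<exists>c\<in>{..<m}. A c f) \<le> n * b"
    if "\<And>c. c < m \<Longrightarrow> Pr (A c) \<le> b" "b \<ge> 0" for A and b :: real
  proof -
    have "Pr (\<lambda>f. \<exists>c\<in>{..<m}. A c f) \<le> (\<Sum>c\<in>{..<m}. b)"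
      by (rule order_trans[OF Pr_Bex_le sum_mono]) (use that in auto)
    also have "\<dots> \<le> n * b" using m_le that(2) by (simp add: mult_right_mono)
    finally show ?thesis .
  qed
  have vertices: "Pr (\<lambda>f. \<exists>v\<in>?W. A v f) \<le> n * b"
    if "\<And>v. v \<in> U \<Longrightarrow> Pr (A v) \<le> b" "b \<ge> 0" for A and b :: real
  proof -
    have "Pr (\<lambda>f. \<exists>v\<in>?W. A v f) \<le> (\<Sum>v\<in>?W. b)"
      by (rule order_trans[OF Pr_Bex_le sum_mono]) (use that finite_U in auto)
    also have "\<dots> \<le> n * b" using card_part[of i] that(2) by (simp add: mult_right_mono)
    finally show ?thesis .
  qed
  have L: "Pr (\<lambda>f. g i c = None \<and> badL f i c) \<le> \<omega>" if "c < m" for c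
    using Pr_badL[OF i that] \<omega> by (cases "g i c = None") (auto simp: Ex_const)
  have N: "Pr (\<lambda>f. \<exists>c\<in>{..<m}. badN1 f v c \<or> badN2 f v c) \<le> n * (2 * \<omega>)" if "v \<in> U" for v
  proof (rule colours)
    fix c assume "c < m"
    then show "Pr (\<lambda>f. badN1 f v c \<or> badN2 f v c) \<le> 2 * \<omega>"
      using order_trans[OF union add_mono[OF Pr_badN1 Pr_badN2]] that a1 \<kappa>1 by fastforce
  qed (use \<omega> in auto)
  have V: "Pr (\<lambda>f. badH1 f v \<or> badH2 f v \<or> (\<exists>c\<in>{..<m}. badN1 f v c \<or> badN2 f v c)) \<le> 2 * \<omega> + n * (2 * \<omega>)"
    if v: "v \<in> U" for v
  proof -
    have "Pr (\<lambda>f. badH1 f v \<or> badH2 f v \<or> (\<exists>c\<in>{..<m}. badN1 f v c \<or> badN2 f v c))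
        \<le> Pr (\<lambda>f. badH1 f v) + Pr (\<lambda>f. badH2 f v \<or> (\<exists>c\<in>{..<m}. badN1 f v c \<or> badN2 f v c))"
      by (rule union)
    also have "Pr (\<lambda>f. badH2 f v \<or> (\<exists>c\<in>{..<m}. badN1 f v c \<or> badN2 f v c))
        \<le> Pr (\<lambda>f. badH2 f v) + Pr (\<lambda>f. \<exists>c\<in>{..<m}. badN1 f v c \<or> badN2 f v c)"
      by (rule union)
    finally show ?thesis using Pr_badH1[OF v a1] Pr_badH2[OF v \<kappa>1] N[OF v] by linarith
  qed
  have "Pr (bad i) \<le> Pr (\<lambda>f. \<exists>c\<in>{..<m}. g i c = None \<and> badL f i c)
      + Pr (\<lambda>f. \<exists>v\<in>?W. badH1 f v \<or> badH2 f v \<or> (\<exists>c\<in>{..<m}. badN1 f v c \<or> badN2 f v c))"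
    unfolding bad_def by (rule union)
  \<comment> \<open>One list failure per colour; for each vertex two failures \<open>badH1\<close>,
    \<open>badH2\<close> and two more for every colour.\<close>
  also have "\<dots> \<le> n * \<omega> + n * (2 * \<omega> + n * (2 * \<omega>))"
    using \<omega> L V by (intro add_mono colours vertices) auto
  also have "\<dots> = (3 * n + 2 * n\<^sup>2) * \<omega>" by (simp add: algebra_simps power2_eq_square)
  also have "\<dots> \<le> (5 * n\<^sup>2) * \<omega>"
    using n_pos \<omega> by (intro mult_right_mono) (auto simp: power2_eq_square simp flip: of_nat_mult of_nat_add)
  finally show ?thesis by simp
qed

text \<open>The failures of part \<open>i\<close> inspect neighbours, whose parts lie in
  \<open>ball1 i\<close>, and whether picks there are risky; the latter reads picks in parts
  adjacent to those, still within \<open>ball2 i\<close>.\<close>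

lemma depends_bad:
  assumes i: "i \<in> P"
  shows "depends (bad i) {t \<in> trials. tpart t \<in> ball2 i}"
proof (rule dependsI)
  fix f f' :: "'a trial \<Rightarrow> 'a option"
  assume ff: "\<And>t. t \<in> {t \<in> trials. tpart t \<in> ball2 i} \<Longrightarrow> f t = f' t"
  have b2: "j \<in> ball2 i" if "j' \<in> ball1 i" "j \<in> ball1 j'" for j j'
    using that by (auto simp: ball2_def)
  have hC: "hitC f v c = hitC f' v c" and hV: "hitV f v = hitV f' v" if "pt v \<in> ball1 i" for v c
    using ff b2[OF that] ball1_self[of "pt v"] by (intro hitC_cong hitV_cong; auto)+
  have pick: "f (Pick j c) = f' (Pick j c)" if "j \<in> ball2 i" "j \<in> P" "c < m" for j c
    using that by (intro ff) (auto simp: in_trials)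
  have rk: "risky f j c = risky f' j c" if "j \<in> ball1 i" "j \<in> P" "c < m" "g j c = None" for j c
  proof -
    have "lost f j c = lost f' j c"
      using that b2[OF that(1)] ball1_self[of j] by (intro lost_cong pick) auto
    then show ?thesis by (simp add: risky_def)
  qed
  have self: "i \<in> ball1 i" "i \<in> ball2 i" using ball1_self ball1_subset_ball2 by auto
  have L: "badL f i c = badL f' i c" if "c < m" "g i c = None" for c
  proof -
    have "{v \<in> L i c. hitV f v \<or> hitC f v c} = {v \<in> L i c. hitV f' v \<or> hitC f' v c}"
      using L_props(5)[OF i that] hC hV self by (intro Collect_cong conj_cong refl) auto
    then show ?thesis by (simp add: badL_def)
  qed
  have "badH1 f v = badH1 f' v \<and> badH2 f v = badH2 f' v \<and>
      (\<forall>c<m. badN1 f v c = badN1 f' v c \<and> badN2 f v c = badN2 f' v c)" if v: "v \<in> U" "pt v = i" for v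
  proof (intro conjI allI impI)
    have "{c \<in> H v. f (Pick (pt v) c) = None \<and> \<not> hitC f v c} = {c \<in> H v. f' (Pick (pt v) c) = None \<and> \<not> hitC f' v c}"
      using hC[of v] pick[of i] H_props[of _ v] i v self by (intro Collect_cong conj_cong refl) auto
    then show "badH1 f v = badH1 f' v" by (simp add: badH1_def)
    have "{c \<in> H v. f (Pick (pt v) c) \<in> risky f (pt v) c} = {c \<in> H v. f' (Pick (pt v) c) \<in> risky f' (pt v) c}"
      using rk[of i] pick[of i] H_props[of _ v] i v self by (intro Collect_cong conj_cong refl) auto
    then show "badH2 f v = badH2 f' v" by (simp add: badH2_def)
    fix c assume c: "c < m"
    have u: "pt u \<in> ball1 i" "pt u \<in> ball2 i" "pt u \<in> P" "g (pt u) c = None" if "u \<in> N v c" for u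
      using N_U[OF that] ball1_nbr[of v u] ball1_subset_ball2[of i] v by auto
    have "{u \<in> N v c. f (Pick (pt u) c) = None \<and> \<not> hitV f u} = {u \<in> N v c. f' (Pick (pt u) c) = None \<and> \<not> hitV f' u}"
      using hV pick u c by (intro Collect_cong conj_cong refl) auto
    then show "badN1 f v c = badN1 f' v c" by (simp add: badN1_def)
    have "{u \<in> N v c. f (Pick (pt u) c) \<in> risky f (pt u) c} = {u \<in> N v c. f' (Pick (pt u) c) \<in> risky f' (pt u) c}"
      using rk pick u c by (intro Collect_cong conj_cong refl) auto
    then show "badN2 f v c = badN2 f' v c" by (simp add: badN2_def)
  qed
  then show "bad i f = bad i f'" using L by (auto simp: bad_def)
qed

text \<open>Failures of two parts share a trial only if their radius-2 balls meet, so each part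
  depends on at most (n^2 + 1)^4 parts, itself included. This is independent of the number of
  parts.\<close>

lemma exists_good_outcome:
  assumes a1: "a \<ge> 1" and \<kappa>1: "\<kappa> \<le> 1"
    and big: "4 * (5 * real n ^ 2 * \<omega>) * (real n ^ 2 + 1) ^ 4 \<le> 1"
  obtains f where "f \<in> supp" "\<And>i. i \<in> P \<Longrightarrow> \<not> bad i f"
proof -
  let ?vbl = "\<lambda>i. {t \<in> trials. tpart t \<in> ball2 i}"
  have "\<exists>f\<in>supp. \<forall>i\<in>P. \<not> bad i f"
  proof (rule local_lemma[OF finite_P depends_bad])
    fix i assume i: "i \<in> P"
    show "?vbl i \<subseteq> trials" by auto
    show "Pr (bad i) \<le> 5 * real n ^ 2 * \<omega>" using Pr_bad[OF i a1 \<kappa>1] by simp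
    have sub: "{j \<in> P. j = i \<or> ?vbl i \<inter> ?vbl j \<noteq> {}} \<subseteq> (\<Union>j\<in>ball2 i. ball2 j)"
    proof
      fix j assume j: "j \<in> {j \<in> P. j = i \<or> ?vbl i \<inter> ?vbl j \<noteq> {}}"
      have "i \<in> ball2 i" using ball1_self ball1_subset_ball2 by blast
      then show "j \<in> (\<Union>j\<in>ball2 i. ball2 j)" using j ball2_sym by auto
    qed
    have *: "finite (\<Union>j\<in>ball2 i. ball2 j) \<and> card (\<Union>j\<in>ball2 i. ball2 j) \<le> (n\<^sup>2 + 1)\<^sup>2 * (n\<^sup>2 + 1)\<^sup>2"
      by (intro card_UN_mult card_ball2)
    then have "card {j \<in> P. j = i \<or> ?vbl i \<inter> ?vbl j \<noteq> {}} \<le> (n\<^sup>2 + 1)\<^sup>2 * (n\<^sup>2 + 1)\<^sup>2"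
      using card_mono[OF _ sub] by linarith
    then have "real (card {j \<in> P. j = i \<or> ?vbl i \<inter> ?vbl j \<noteq> {}}) \<le> real ((n\<^sup>2 + 1)\<^sup>2 * (n\<^sup>2 + 1)\<^sup>2)"
      unfolding of_nat_le_iff .
    also have "\<dots> = (real n ^ 2 + 1) ^ 4"
      by (simp add: power_add[symmetric] flip: of_nat_power) (simp add: algebra_simps)
    finally show "real (card {j \<in> P. j = i \<or> ?vbl i \<inter> ?vbl j \<noteq> {}}) \<le> (real n ^ 2 + 1) ^ 4" .
  qed (assumption | rule big)+
  then show thesis using that by blast
qed

section \<open>The state after the round\<close>

lemma hitV_Pick: "v \<in> U \<Longrightarrow> c < m \<Longrightarrow> f (Pick (pt v) c) = Some v \<Longrightarrow> hitV f v"
  unfolding hitV_def by (rule bexI[of _ "Pick (pt v) c"]) (auto simp: kV_def in_trials pt_P)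

lemma hitC_Pick: "E v u \<Longrightarrow> c < m \<Longrightarrow> f (Pick (pt u) c) = Some u \<Longrightarrow> hitC f v c"
  unfolding hitC_def by (rule bexI[of _ "Pick (pt u) c"]) (auto simp: kC_def in_trials pt_P E_U2)

lemma early_hit:
  assumes "v \<in> U" "pt v = i" "c < m" "early f i c v" shows "hitV f v \<or> hitC f v c"
  using assms(4) unfolding early_def
proof (elim disjE exE conjE)
  fix c' assume "c' < c" "f (Pick i c') = Some v"
  then show ?thesis using hitV_Pick[of v c' f] assms by simp
next
  fix u assume "E v u" "f (Pick (pt u) c) = Some u"
  then show ?thesis using hitC_Pick[of v u c f] assms by simp
qed

definition next_col :: "('a trial \<Rightarrow> 'a option) \<Rightarrow> nat \<Rightarrow> nat \<Rightarrow> 'a option" where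
  "next_col f i c = (case g i c of Some v \<Rightarrow> Some v | None \<Rightarrow>
     (case f (Pick i c) of None \<Rightarrow> None | Some v \<Rightarrow> if early f i c v then None else Some v))"

definition next_S where "next_S f = {v \<in> S. \<not> hitV f v}"
definition next_L where "next_L f i c = {v \<in> L i c. \<not> hitV f v \<and> \<not> hitC f v c}"

lemma next_col_Some:
  "next_col f i c = Some v \<longleftrightarrow> g i c = Some v \<or> g i c = None \<and> f (Pick i c) = Some v \<and> \<not> early f i c v"
  by (auto simp: next_col_def split: option.splits)

lemma next_col_None:
  "next_col f i c = None \<longleftrightarrow> g i c = None \<and> (\<forall>v. f (Pick i c) = Some v \<longrightarrow> early f i c v)"
  by (auto simp: next_col_def split: option.splits)

text \<open>Every pick, kept or not, hits its vertex and strikes the neighbours of that vertex from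
  the lists of its colour, which preserves the structural conditions. The new numerical bounds come
  from the absence of failures; the two classes of remaining pairs each contribute a deviation
  \<open>s\<close>, hence 2 * s.\<close>

lemma next_state:
  assumes f: "f \<in> supp" and good: "\<And>i. i \<in> P \<Longrightarrow> \<not> bad i f"
  shows "nibble_state P U pt E n m C (a * (1 - 2 * y) - s) (e * (\<sigma> + \<theta> * \<kappa>) + 2 * s)
    (next_col f) (next_S f) (next_L f)"
proof unfold_locales
  have newL: "v \<in> L i c \<and> v \<in> S \<and> pt v = i \<and> v \<in> U"
    if "i \<in> P" "c < m" "g i c = None" "f (Pick i c) = Some v" for i c v
    using supp_Pick[OF f that(1,2,4)] L_S[OF that(1-3)] S_U by auto
  \<comment> \<open>Of two adjacent vertices picked for one colour, the one in the later part
    satisfies \<open>early\<close> and is dropped. The order of the parts is fixed here and removed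
    by symmetry below.\<close>
  have noconf: False
    if *: "i \<in> P" "j \<in> P" "c < m" "next_col f i c = Some u" "next_col f j c = Some v" "E u v" "pt v < pt u" for i j c u v
  proof -
    consider "g i c = Some u" "g j c = Some v" | "g i c = Some u" "g j c = None" "f (Pick j c) = Some v"
      | "g i c = None" "f (Pick i c) = Some u" "g j c = Some v"
      | "g i c = None" "f (Pick i c) = Some u" "\<not> early f i c u" "g j c = None" "f (Pick j c) = Some v"
      using *(4,5) unfolding next_col_Some by auto
    then show False
    proof cases
      case 1 then show ?thesis using col_indep[OF *(1-3) 1] *(6) by simp
    next
      case 2 then show ?thesis
        using L_indep[OF *(2,1,3) 2(2) _ 2(1)] newL[OF *(2,3) 2(2,3)] E_sym[OF *(6)] by simp
    next
      case 3 then show ?thesis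
        using L_indep[OF *(1,2,3) 3(1) _ 3(3)] newL[OF *(1,3) 3(1,2)] *(6) by simp
    next
      case 4
      then have "pt u = i" "pt v = j" using newL[OF *(1,3) 4(1,2)] newL[OF *(2,3) 4(4,5)] by auto
      then have "early f i c u" using *(6,7) 4(5) unfolding early_def by auto
      then show ?thesis using 4(3) by simp
    qed
  qed
  show "next_S f \<subseteq> U" using S_U by (auto simp: next_S_def)
  show "v \<in> U \<and> pt v = i \<and> v \<notin> next_S f" if "i \<in> P" "c < m" "next_col f i c = Some v" for i c v
    using that col[OF that(1,2), of v] newL[OF that(1,2), of v] hitV_Pick[of v c f]
    by (auto simp: next_col_Some next_S_def)
  show "c = c'" if *: "i \<in> P" "c < m" "c' < m" "next_col f i c = Some v" "next_col f i c' = Some v" for i c c' v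
  proof -
    consider "g i c = Some v" "g i c' = Some v" | "g i c = Some v" "g i c' = None" "f (Pick i c') = Some v"
      | "g i c = None" "f (Pick i c) = Some v" "g i c' = Some v"
      | "g i c = None" "f (Pick i c) = Some v" "\<not> early f i c v" "g i c' = None" "f (Pick i c') = Some v" "\<not> early f i c' v"
      using *(4,5) unfolding next_col_Some by auto
    then show ?thesis
    proof cases
      case 1 then show ?thesis using col_inj[OF *(1-3)] by simp
    next
      case 2 then show ?thesis using col[OF *(1,2) 2(1)] newL[OF *(1,3) 2(2,3)] by simp
    next
      case 3 then show ?thesis using col[OF *(1,3) 3(3)] newL[OF *(1,2) 3(1,2)] by simp
    next
      case 4
      then have "\<not> c < c'" "\<not> c' < c" by (auto simp: early_def)
      then show ?thesis by simp
    qed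
  qed
  show "\<not> E u v" if *: "i \<in> P" "j \<in> P" "c < m" "next_col f i c = Some u" "next_col f j c = Some v" for i j c u v
  proof
    assume uv: "E u v"
    then consider "pt v < pt u" | "pt u < pt v" using E_pt nat_neq_iff by blast
    then show False
      using noconf[OF * uv] noconf[OF *(2,1,3,5,4) E_sym[OF uv]] by cases auto
  qed
  show "next_L f i c \<subseteq> {v \<in> next_S f. pt v = i}" if "i \<in> P" "c < m" "next_col f i c = None" for i c
    using L_S[OF that(1,2)] that(3) by (auto simp: next_col_None next_L_def next_S_def)
  show "\<not> E u v" if *: "i \<in> P" "j \<in> P" "c < m" "next_col f i c = None" "u \<in> next_L f i c" "next_col f j c = Some v" for i j c u v
  proof
    assume uv: "E u v"
    have u: "u \<in> L i c" "\<not> hitC f u c" "g i c = None" using * by (auto simp: next_L_def next_col_None)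
    then have new: "g j c = None" "f (Pick j c) = Some v"
      using L_indep[OF *(1-3) u(3,1), of v] *(6) uv by (auto simp: next_col_Some)
    then show False using hitC_Pick[OF uv *(3), of f] newL[OF *(2,3) new] u by simp
  qed
  \<comment> \<open>A pair that picked and stayed uncoloured was rejected, so its pick lies in
    \<open>lost\<close>; as \<open>badL\<close> fails, the cap is inactive and the pick is
    risky.\<close>
  have risk: "f (Pick i c) \<in> risky f i c" if *: "i \<in> P" "c < m" "next_col f i c = None" "f (Pick i c) \<noteq> None" for i c
  proof -
    obtain v where v: "f (Pick i c) = Some v" "early f i c v" "g i c = None"
      using * unfolding next_col_None by auto
    have gi: "g i c = None" using v by simp
    note Lp = L_props[OF *(1,2) gi]
    have "lost f i c \<subseteq> {v \<in> L i c. hitV f v \<or> hitC f v c}"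
    proof
      fix v assume "v \<in> lost f i c"
      then have v: "v \<in> L i c" "early f i c v" by (auto simp: lost_def)
      then show "v \<in> {v \<in> L i c. hitV f v \<or> hitC f v c}"
        using early_hit[OF subsetD[OF Lp(2) v(1)] Lp(5)[OF v(1)] *(2) v(2)] by simp
    qed
    then have "card (lost f i c) \<le> card {v \<in> L i c. hitV f v \<or> hitC f v c}"
      using Lp(1) by (intro card_mono) auto
    moreover have "\<not> badL f i c" using good[OF *(1)] gi *(2) unfolding bad_def by blast
    ultimately have "card (lost f i c) \<le> 2 * y * card (L i c) + s" unfolding badL_def by linarith
    then show ?thesis using v newL[OF *(1,2) gi v(1)] by (auto simp: risky_def lost_def)
  qed
  show "a * (1 - 2 * y) - s \<le> real (card (next_L f i c))" if *: "i \<in> P" "c < m" "next_col f i c = None" for i c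
  proof -
    have gi: "g i c = None" using * by (simp add: next_col_None)
    note Lp = L_props[OF *(1,2) gi]
    let ?K = "{v \<in> L i c. hitV f v \<or> hitC f v c}"
    have "next_L f i c = L i c - ?K" by (auto simp: next_L_def)
    then have "real (card (next_L f i c)) = real (card (L i c)) - real (card ?K)"
      using Lp(1) by (simp add: card_Diff_subset card_mono of_nat_diff)
    moreover have "\<not> badL f i c" using good[OF *(1)] gi *(2) unfolding bad_def by blast
    moreover have "a * (1 - 2 * y) \<le> real (card (L i c)) * (1 - 2 * y)"
      using card_L[OF *(1,2) gi] y_bounds by (intro mult_right_mono) auto
    ultimately show ?thesis unfolding badL_def by (simp add: algebra_simps)
  qed
  show "real (card {c. c < m \<and> next_col f (pt v) c = None \<and> v \<in> next_L f (pt v) c}) \<le> e * (\<sigma> + \<theta> * \<kappa>) + 2 * s"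
    if v: "v \<in> U" for v
  proof -
    let ?A = "{c \<in> H v. f (Pick (pt v) c) = None \<and> \<not> hitC f v c}"
    let ?B = "{c \<in> H v. f (Pick (pt v) c) \<in> risky f (pt v) c}"
    have "{c. c < m \<and> next_col f (pt v) c = None \<and> v \<in> next_L f (pt v) c} \<subseteq> ?A \<union> ?B"
    proof
      fix c assume c: "c \<in> {c. c < m \<and> next_col f (pt v) c = None \<and> v \<in> next_L f (pt v) c}"
      then have "c \<in> H v" "\<not> hitC f v c" by (auto simp: H_def next_L_def next_col_None)
      then show "c \<in> ?A \<union> ?B" using risk[OF pt_P[OF v], of c] c
        by (cases "f (Pick (pt v) c) = None") simp_all
    qed
    then have "card {c. c < m \<and> next_col f (pt v) c = None \<and> v \<in> next_L f (pt v) c} \<le> card (?A \<union> ?B)"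
      using finite_H by (intro card_mono) auto
    also have "\<dots> \<le> card ?A + card ?B" by (rule card_Un_le)
    finally have "real (card {c. c < m \<and> next_col f (pt v) c = None \<and> v \<in> next_L f (pt v) c}) \<le> real (card ?A) + real (card ?B)"
      by simp
    moreover have "\<not> badH1 f v \<and> \<not> badH2 f v" using good[OF pt_P[OF v]] v by (auto simp: bad_def)
    ultimately show ?thesis unfolding badH1_def badH2_def by (simp add: algebra_simps)
  qed
  show "real (card {u \<in> next_S f. E v u \<and> next_col f (pt u) c = None}) \<le> e * (\<sigma> + \<theta> * \<kappa>) + 2 * s"
    if v: "v \<in> U" and c: "c < m" for v c
  proof -
    let ?A = "{u \<in> N v c. f (Pick (pt u) c) = None \<and> \<not> hitV f u}"
    let ?B = "{u \<in> N v c. f (Pick (pt u) c) \<in> risky f (pt u) c}"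
    have "{u \<in> next_S f. E v u \<and> next_col f (pt u) c = None} \<subseteq> ?A \<union> ?B"
    proof
      fix u assume u: "u \<in> {u \<in> next_S f. E v u \<and> next_col f (pt u) c = None}"
      then have "u \<in> N v c" "\<not> hitV f u" by (simp_all add: N_def next_S_def next_col_None)
      moreover from this have "pt u \<in> P" using N_U by blast
      ultimately show "u \<in> ?A \<union> ?B" using risk[of "pt u" c] u c
        by (cases "f (Pick (pt u) c) = None") simp_all
    qed
    then have "card {u \<in> next_S f. E v u \<and> next_col f (pt u) c = None} \<le> card (?A \<union> ?B)"
      using finite_N by (intro card_mono) auto
    also have "\<dots> \<le> card ?A + card ?B" by (rule card_Un_le)
    finally have "real (card {u \<in> next_S f. E v u \<and> next_col f (pt u) c = None}) \<le> real (card ?A) + real (card ?B)"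
      by simp
    moreover have "\<not> badN1 f v c \<and> \<not> badN2 f v c" using good[OF pt_P[OF v]] v c by (auto simp: bad_def)
    ultimately show ?thesis unfolding badN1_def badN2_def by (simp add: algebra_simps)
  qed
qed

end

subsection \<open>Completing the colouring\<close>

definition full_colouring :: "nat set \<Rightarrow> 'a set \<Rightarrow> ('a \<Rightarrow> nat) \<Rightarrow> ('a \<Rightarrow> 'a \<Rightarrow> bool) \<Rightarrow> nat \<Rightarrow> (nat \<Rightarrow> nat \<Rightarrow> 'a) \<Rightarrow> bool" where
  "full_colouring P U pt E m h \<longleftrightarrow>
     (\<forall>i\<in>P. \<forall>c<m. h i c \<in> U \<and> pt (h i c) = i) \<and>
     (\<forall>i\<in>P. inj_on (h i) {..<m}) \<and>
     (\<forall>i\<in>P. \<forall>j\<in>P. \<forall>c<m. \<not> E (h i c) (h j c))"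

context nibble_state
begin

text \<open>Each uncoloured pair picks uniformly from \<open>b\<close> list vertices, and the events
  are single conflicts of probability 1 / b^2. A pair takes part in at most 4 b e of them, so an
  event meets at most 8 b e, and 4 * (1 / b^2) * 8 b e = 32 e / b \<le> 1.\<close>

lemma finish:
  assumes a: "a > 0" and e: "0 \<le> e" "32 * e \<le> a"
  shows "\<exists>h. full_colouring P U pt E m h"
proof -
  define b where "b = nat \<lceil>a\<rceil>"
  have b: "b > 0" "a \<le> real b" using a by (simp_all add: b_def real_nat_ceiling_ge)
  define I where "I = {(i, c). i \<in> P \<and> c < m \<and> g i c = None}"
  have finI: "finite I"
    by (rule finite_subset[of _ "P \<times> {..<m}"]) (auto simp: I_def finite_P)
  \<comment> \<open>Lists are cut to the common size \<open>b\<close>; a longer list would involve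
    its pair in more conflicts than the uniform count allows.\<close>
  define M where "M i c = (SOME M. M \<subseteq> L i c \<and> card M = b)" for i c
  have M0: "M i c \<subseteq> L i c \<and> card (M i c) = b" if "(i, c) \<in> I" for i c
  proof -
    have "a \<le> real (card (L i c))" using card_L[of i c] that by (auto simp: I_def)
    then have "b \<le> card (L i c)" unfolding b_def by linarith
    then obtain M where "M \<subseteq> L i c" "card M = b" by (rule obtain_subset_with_card_n)
    then have "\<exists>M. M \<subseteq> L i c \<and> card M = b" by blast
    then show ?thesis unfolding M_def by (rule someI_ex)
  qed
  have M: "M i c \<subseteq> L i c" "card (M i c) = b" "finite (M i c)" "M i c \<subseteq> U" "M i c \<subseteq> S" "\<And>v. v \<in> M i c \<Longrightarrow> pt v = i"
    if "(i, c) \<in> I" for i c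
  proof -
    show "M i c \<subseteq> L i c" "card (M i c) = b" using M0[OF that] by auto
    then show "finite (M i c)" using b by (intro card_ge_0_finite) simp
    show "M i c \<subseteq> U" "M i c \<subseteq> S" "\<And>v. v \<in> M i c \<Longrightarrow> pt v = i"
      using M0[OF that] L_S[of i c] S_U that by (auto simp: I_def)
  qed
  define w where "w = (\<lambda>(i, c) v. of_bool (v \<in> M i c) / real b)"
  interpret fin_prod I U w
  proof
    fix t assume t: "t \<in> I"
    obtain i c where ic: "t = (i, c)" by (cases t)
    have "(\<Sum>v\<in>U. w t v) = real (card (U \<inter> M i c)) / real b"
      using finite_U by (simp add: ic w_def flip: sum_divide_distrib)
    also have "U \<inter> M i c = M i c" using M(4)[of i c] t ic by auto
    finally show "(\<Sum>v\<in>U. w t v) = 1" using M(2)[of i c] b t ic by simp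
  qed (auto simp: finI finite_U w_def)
  define conf where "conf v c u c' \<longleftrightarrow> c = c' \<and> E v u \<or> v = u \<and> c \<noteq> c'" for v u :: 'a and c c' :: nat
  define item where "item v c \<longleftrightarrow> (pt v, c) \<in> I \<and> v \<in> M (pt v) c" for v c
  define J where "J = {((v, c), (u, c')). item v c \<and> item u c' \<and> conf v c u c'}"
  define A where "A = (\<lambda>((v :: 'a, c :: nat), (u :: 'a, c' :: nat)) f. f (pt v, c) = v \<and> f (pt u, c') = u)"
  define vbl where "vbl = (\<lambda>((v :: 'a, c :: nat), (u :: 'a, c' :: nat)). {(pt v, c), (pt u, c')})"
  have conf_sym: "conf v c u c' \<longleftrightarrow> conf u c' v c" for v c u c'
    unfolding conf_def using E_sym by blast
  have item_U: "v \<in> U \<and> c < m \<and> v \<in> S \<and> g (pt v) c = None \<and> v \<in> L (pt v) c" if "item v c" for v c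
  proof -
    have I: "(pt v, c) \<in> I" and v: "v \<in> M (pt v) c" using that by (simp_all add: item_def)
    show ?thesis using I subsetD[OF M(1)[OF I] v] subsetD[OF M(4)[OF I] v] subsetD[OF M(5)[OF I] v]
      by (simp add: I_def)
  qed
  have finJ: "finite J"
  proof (rule finite_subset)
    show "J \<subseteq> (U \<times> {..<m}) \<times> (U \<times> {..<m})" using item_U by (fastforce simp: J_def)
  qed (simp add: finite_U)
  \<comment> \<open>At most \<open>e\<close> colours for the same vertex and at most
    \<open>e\<close> neighbours for the same colour.\<close>
  have partners: "real (card {(u, c'). item u c' \<and> conf v c u c'}) \<le> 2 * e" if vc: "item v c" for v c
  proof -
    let ?H = "{c. c < m \<and> g (pt v) c = None \<and> v \<in> L (pt v) c}"
    let ?N = "{u \<in> S. E v u \<and> g (pt u) c = None}"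
    have sub: "{(u, c'). item u c' \<and> conf v c u c'} \<subseteq> (\<lambda>c'. (v, c')) ` ?H \<union> (\<lambda>u. (u, c)) ` ?N"
      using item_U by (auto simp: conf_def)
    have fN: "finite ?N" by (rule finite_nbrs)
    have "card {(u, c'). item u c' \<and> conf v c u c'} \<le> card ((\<lambda>c'. (v, c')) ` ?H \<union> (\<lambda>u. (u, c)) ` ?N)"
      by (rule card_mono[OF _ sub]) (use fN in auto)
    also have "\<dots> \<le> card ((\<lambda>c'. (v, c')) ` ?H) + card ((\<lambda>u. (u, c)) ` ?N)" by (rule card_Un_le)
    also have "\<dots> \<le> card ?H + card ?N" using fN by (intro add_mono card_image_le) auto
    finally show ?thesis using card_H[of v] card_N[of v c] item_U[OF vc] by linarith
  qed
  \<comment> \<open>There are \<open>b\<close> possible picks, each with at most 2 e partners.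
    Conflicts are ordered pairs; swapping covers those in which the given trial comes second and
    doubles the count.\<close>
  have trial: "finite {x \<in> J. t \<in> vbl x} \<and> real (card {x \<in> J. t \<in> vbl x}) \<le> 4 * real b * e" if t: "t \<in> I" for t
  proof -
    obtain i c where ic: "t = (i, c)" by (cases t)
    define D where "D = (SIGMA p : (\<lambda>v. (v, c)) ` M i c. {(u, c'). item u c' \<and> conf (fst p) (snd p) u c'})"
    have fin: "finite {(u, c'). item u c' \<and> conf v d u c'}" for v d
      by (rule finite_subset[of _ "U \<times> {..<m}"]) (use item_U in \<open>auto simp: finite_U\<close>)
    have fM: "finite (M i c)" using M(3) t ic by simp
    have fD: "finite D" using fM fin by (auto simp: D_def)
    have "card D = (\<Sum>p\<in>(\<lambda>v. (v, c)) ` M i c. card {(u, c'). item u c' \<and> conf (fst p) (snd p) u c'})"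
      unfolding D_def using fM fin by (intro card_SigmaI) auto
    also have "\<dots> = (\<Sum>v\<in>M i c. card {(u, c'). item u c' \<and> conf v c u c'})"
      by (subst sum.reindex) (auto simp: inj_on_def)
    finally have "real (card D) = (\<Sum>v\<in>M i c. real (card {(u, c'). item u c' \<and> conf v c u c'}))"
      by simp
    also have "\<dots> \<le> (\<Sum>v\<in>M i c. 2 * e)"
      using t ic M by (intro sum_mono partners) (auto simp: item_def)
    also have "\<dots> = 2 * real b * e" using M(2)[of i c] t ic by simp
    finally have cD: "real (card D) \<le> 2 * real b * e" .
    have sub: "{x \<in> J. t \<in> vbl x} \<subseteq> D \<union> prod.swap ` D"
    proof
      fix x assume x: "x \<in> {x \<in> J. t \<in> vbl x}"
      obtain v d u d' where xe: "x = ((v, d), (u, d'))" by (metis prod.exhaust)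
      have "(v, d) \<in> (\<lambda>v. (v, c)) ` M i c \<or> (u, d') \<in> (\<lambda>v. (v, c)) ` M i c"
        using x by (auto simp: xe J_def vbl_def ic item_def)
      then have "x \<in> D \<or> prod.swap x \<in> D"
        using x conf_sym[of v d u d'] by (auto simp: xe J_def D_def)
      then show "x \<in> D \<union> prod.swap ` D" by (metis UnCI image_eqI swap_swap)
    qed
    have "card {x \<in> J. t \<in> vbl x} \<le> card (D \<union> prod.swap ` D)"
      by (rule card_mono[OF _ sub]) (use fD in auto)
    also have "\<dots> \<le> card D + card (prod.swap ` D)" by (rule card_Un_le)
    also have "\<dots> \<le> card D + card D" using fD by (intro add_mono card_image_le) auto
    finally show ?thesis using cD finJ by simp
  qed
  have "\<exists>f\<in>supp. \<forall>x\<in>J. \<not> A x f"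
  proof (rule local_lemma[OF finJ, where vbl = vbl and p = "1 / real b ^ 2" and d = "8 * real b * e"])
    fix x assume x: "x \<in> J"
    obtain v c u c' where xe: "x = ((v, c), (u, c'))" by (metis prod.exhaust)
    have I: "(pt v, c) \<in> I" "(pt u, c') \<in> I" and vu: "v \<in> M (pt v) c" "u \<in> M (pt u) c'" and cf: "conf v c u c'"
      using x by (auto simp: xe J_def item_def)
    show "depends (A x) (vbl x)" by (rule dependsI) (auto simp: A_def vbl_def xe)
    show "vbl x \<subseteq> I" using I by (auto simp: vbl_def xe)
    have ne: "(pt v, c) \<noteq> (pt u, c')" using cf E_pt[of v u] by (auto simp: conf_def)
    have one: "Pr (\<lambda>f. f (pt v, c) = v) = 1 / b" if "(pt v, c) \<in> I" "v \<in> M (pt v) c" for v c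
    proof -
      have vU: "v \<in> U" using that M(4) by auto
      have "Pr (\<lambda>f. f (pt v, c) = v) = (\<Sum>z\<in>U. w (pt v, c) z * of_bool (z = v))"
        by (rule Ex_single[OF that(1)])
      also have "\<dots> = w (pt v, c) v"
        using vU finite_U by (simp add: of_bool_def if_distrib cong: if_cong)
      finally show ?thesis using that by (simp add: w_def)
    qed
    have "Pr (A x) = Ex (\<lambda>f. of_bool (f (pt v, c) = v) * of_bool (f (pt u, c') = u))"
      by (intro Ex_cong) (simp add: A_def xe)
    also have "\<dots> = Pr (\<lambda>f. f (pt v, c) = v) * Pr (\<lambda>f. f (pt u, c') = u)"
      by (rule Ex_indep[where A = "{(pt v, c)}" and B = "{(pt u, c')}"]) (use I ne in \<open>auto simp: depends_def\<close>)
    finally show "Pr (A x) \<le> 1 / real b ^ 2"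
      using one[OF I(1) vu(1)] one[OF I(2) vu(2)] by (simp add: power2_eq_square)
    have "{x' \<in> J. x' = x \<or> vbl x \<inter> vbl x' \<noteq> {}} \<subseteq> {x' \<in> J. (pt v, c) \<in> vbl x'} \<union> {x' \<in> J. (pt u, c') \<in> vbl x'}"
      by (auto simp: xe vbl_def)
    then have "card {x' \<in> J. x' = x \<or> vbl x \<inter> vbl x' \<noteq> {}} \<le> card ({x' \<in> J. (pt v, c) \<in> vbl x'} \<union> {x' \<in> J. (pt u, c') \<in> vbl x'})"
      using finJ by (intro card_mono) auto
    also have "\<dots> \<le> card {x' \<in> J. (pt v, c) \<in> vbl x'} + card {x' \<in> J. (pt u, c') \<in> vbl x'}" by (rule card_Un_le)
    finally show "real (card {x' \<in> J. x' = x \<or> vbl x \<inter> vbl x' \<noteq> {}}) \<le> 8 * real b * e"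
      using trial[OF I(1)] trial[OF I(2)] by linarith
  next
    show "4 * (1 / (real b)\<^sup>2) * (8 * real b * e) \<le> 1"
      using b e by (simp add: power2_eq_square field_simps)
  qed
  then obtain f where f: "f \<in> supp" and nA: "\<And>x. x \<in> J \<Longrightarrow> \<not> A x f" by blast
  define h where "h i c = (case g i c of Some v \<Rightarrow> v | None \<Rightarrow> f (i, c))" for i c
  have fM: "f (i, c) \<in> M i c" if "(i, c) \<in> I" for i c
    using suppD[OF f that] by (cases "f (i, c) \<in> M i c") (simp_all add: w_def)
  have none: "(i, c) \<in> I \<and> h i c \<in> L i c \<and> h i c \<in> U \<and> pt (h i c) = i \<and> item (h i c) c \<and> h i c = f (i, c) \<and> h i c \<in> S"
    if "i \<in> P" "c < m" "g i c = None" for i c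
  proof -
    have I: "(i, c) \<in> I" using that by (simp add: I_def)
    show ?thesis using I fM[OF I] M[OF I] that(3) by (auto simp: h_def item_def)
  qed
  have some: "h i c = v" if "g i c = Some v" for i c v using that by (simp add: h_def)
  have noconf: "\<not> conf (h i c) c (h j c') c'"
    if "i \<in> P" "c < m" "g i c = None" "j \<in> P" "c' < m" "g j c' = None" for i c j c'
    using nA[of "((h i c, c), (h j c', c'))"] none[OF that(1-3)] none[OF that(4-6)] by (auto simp: J_def A_def)
  have "full_colouring P U pt E m h"
    unfolding full_colouring_def
  proof (intro conjI ballI allI impI)
    fix i c assume ic: "i \<in> P" "c < m"
    show "h i c \<in> U" "pt (h i c) = i"
      using none[OF ic] col[OF ic] some[of i c] by (cases "g i c"; auto)+
    fix j assume j: "j \<in> P"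
    show "\<not> E (h i c) (h j c)"
    proof (cases "g i c"; cases "g j c")
      assume "g i c = None" "g j c = None"
      then show ?thesis using noconf ic j by (auto simp: conf_def)
    next
      fix v assume *: "g i c = None" "g j c = Some v"
      then have "h i c \<in> L i c" using none[OF ic] by blast
      then show ?thesis using L_indep[OF ic(1) j ic(2) *(1) _ *(2)] some[OF *(2)] by metis
    next
      fix v assume *: "g i c = Some v" "g j c = None"
      then have "h j c \<in> L j c" using none[OF j ic(2)] by blast
      then have "\<not> E (h j c) (h i c)" using L_indep[OF j ic *(2) _ *(1)] some[OF *(1)] by metis
      then show ?thesis using E_sym by blast
    next
      fix v u assume *: "g i c = Some v" "g j c = Some u"
      then show ?thesis using col_indep[OF ic(1) j ic(2) *] some by simp
    qed
  next
    fix i assume i: "i \<in> P"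
    show "inj_on (h i) {..<m}"
    proof (rule inj_onI, rule ccontr)
      fix c c' assume cc: "c \<in> {..<m}" "c' \<in> {..<m}" "h i c = h i c'" "c \<noteq> c'"
      then have c: "c < m" "c' < m" by auto
      show False
      proof (cases "g i c"; cases "g i c'")
        assume "g i c = None" "g i c' = None"
        then show False using noconf[OF i c(1) _ i c(2)] cc by (auto simp: conf_def)
      next
        fix v assume *: "g i c = None" "g i c' = Some v"
        then have "h i c \<in> S" using none[OF i c(1)] by blast
        then show False using col[OF i c(2) *(2)] some[OF *(2)] cc(3) by simp
      next
        fix v assume *: "g i c = Some v" "g i c' = None"
        then have "h i c' \<in> S" using none[OF i c(2)] by blast
        then show False using col[OF i c(1) *(1)] some[OF *(1)] cc(3) by simp
      next
        fix v u assume *: "g i c = Some v" "g i c' = Some u"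
        then have "u = v" using some[OF *(1)] some[OF *(2)] cc(3) by simp
        then show False using col_inj[OF i c] * cc(4) by blast
      qed
    qed
  qed
  then show ?thesis by blast
qed

lemma weaken:
  assumes "a' \<le> a" "e \<le> e'"
  shows "nibble_state P U pt E n m C a' e' g S L"
proof unfold_locales
  show "a' \<le> real (card (L i c))" if "i \<in> P" "c < m" "g i c = None" for i c
    using card_L[OF that] assms by linarith
  show "real (card {c. c < m \<and> g (pt v) c = None \<and> v \<in> L (pt v) c}) \<le> e'" if "v \<in> U" for v
    using card_H[OF that] assms by linarith
  show "real (card {u \<in> S. E v u \<and> g (pt u) c = None}) \<le> e'" if "v \<in> U" "c < m" for v c
    using card_N[OF that] assms by linarith
qed (fact S_U col col_inj col_indep L_S L_indep)+

end

subsection \<open>Iterating the rounds\<close>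

text \<open>Multiply by exp z \<ge> 1 + z: the product (1 + z) (1 - z + z^2) = 1 + z^3 is at least
  1.\<close>

lemma exp_minus_le: fixes z :: real assumes "0 \<le> z" shows "exp (- z) \<le> 1 - z + z\<^sup>2"
proof -
  have "0 \<le> 1 - z + z\<^sup>2" using sum_squares_ge_zero[of "z - 1/2" 0] by (simp add: power2_eq_square algebra_simps)
  then have "(1 + z) * (1 - z + z\<^sup>2) \<le> exp z * (1 - z + z\<^sup>2)"
    using exp_ge_add_one_self[of z] by (intro mult_right_mono) auto
  moreover have "(1 + z) * (1 - z + z\<^sup>2) = 1 + z ^ 3" by (simp add: algebra_simps power2_eq_square power3_eq_cube)
  moreover have "z ^ 3 \<ge> 0" using assms by simp
  ultimately have "1 \<le> exp z * (1 - z + z\<^sup>2)" by linarith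
  then show ?thesis by (simp add: exp_minus field_simps)
qed

text \<open>Both the list sizes and the degrees shrink, but the degrees shrink faster: to first order in
  \<open>\<theta>\<close> the ratio \<open>r\<close> is multiplied by \<open>1 - \<theta> (1 - r)\<close>.\<close>

lemma (in nibble_state) nibble_round:
  fixes x r \<theta> s :: real
  assumes x: "0 < x" "x < 1" and \<theta>_eq: "\<theta> = (1 - x) / 24" and r: "0 < r" "r \<le> x" and e: "e = r * a"
    and a: "1 \<le> \<theta> * a" "a \<le> n" and s_bounds: "0 < s" "s \<le> \<theta>\<^sup>2 * r * a"
    and big: "4 * (5 * real n ^ 2 * exp (- s\<^sup>2 / (4 * real C * real n))) * (real n ^ 2 + 1) ^ 4 \<le> 1"
  shows "\<exists>a' g' S' L'. nibble_state P U pt E n m C a' ((1 - \<theta> * (1 - x) / 2) * r * a') g' S' L' \<and>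
    (1 - 3 * \<theta>) * a \<le> a' \<and> a' \<le> a"
proof -
  have \<theta>0: "0 < \<theta>" "\<theta> \<le> 1/24" using x \<theta>_eq by auto
  have a0: "a > 0" using a(1) \<theta>0 by (metis less_le_trans zero_less_mult_pos zero_less_one)
  have a1: "a \<ge> 1" using a(1) \<theta>0 a0 mult_right_mono[of \<theta> 1 a] by linarith
  have \<theta>a: "\<theta> / a \<le> \<theta>\<^sup>2"
    using a(1) a0 \<theta>0 by (simp add: power2_eq_square field_simps)
  have r1: "r < 1" using r x by linarith
  have \<theta>r: "\<theta> * r \<le> \<theta>" "0 < \<theta> * r" using r1 r \<theta>0 by auto
  have \<theta>2: "\<theta>\<^sup>2 \<le> \<theta> / 24" "0 < \<theta>\<^sup>2" using \<theta>0 by (auto simp: power2_eq_square)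
  have \<theta>2r: "\<theta>\<^sup>2 * r \<le> \<theta>\<^sup>2" using r1 \<theta>2 by simp
  have s_le: "s \<le> \<theta>\<^sup>2 * a" using s_bounds(2) mult_right_mono[OF \<theta>2r, of a] a0 by linarith
  interpret nibble_step P U pt E n m C a e g S L \<theta> s
  proof unfold_locales
    show "0 < \<theta>" "\<theta> \<le> 1" using \<theta>0 by auto
    show "0 < a" "0 \<le> e" using a0 e r by auto
    have "2 * (\<theta> * r) \<le> 1" using \<theta>r \<theta>0 by linarith
    then have "2 * (\<theta> * r) * a \<le> 1 * a" using a0 by (intro mult_right_mono) auto
    then show "2 * \<theta> * e \<le> a" by (simp add: e mult_ac)
    have "r * a \<le> 1 * a" using r1 a0 by (intro mult_right_mono) auto
    then show "e \<le> real n" using a(2) e by simp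
    show "0 < s" by (rule s_bounds)
    have "\<theta>\<^sup>2 \<le> 1" using \<theta>2 \<theta>0 by linarith
    then have "\<theta>\<^sup>2 * a \<le> 1 * a" using a0 by (intro mult_right_mono) auto
    then show "s \<le> real n" using s_le a(2) by simp
  qed
  have y: "y = \<theta> * r" unfolding y_def using a0 e by simp
  have sa: "s / a \<le> \<theta>\<^sup>2" using s_le a0 by (simp add: field_simps)
  have \<kappa>: "\<kappa> \<le> 3 * \<theta>" unfolding \<kappa>_def y using sa \<theta>r \<theta>2 \<theta>0 by linarith
  have \<kappa>1: "\<kappa> \<le> 1" using \<kappa> \<theta>0 by linarith
  obtain f where f: "f \<in> supp" "\<And>i. i \<in> P \<Longrightarrow> \<not> bad i f"
    using exists_good_outcome[OF a1 \<kappa>1] big unfolding \<omega>_def by metis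
  have st: "nibble_state P U pt E n m C (a * (1 - 2 * y) - s) (e * (\<sigma> + \<theta> * \<kappa>) + 2 * s)
      (next_col f) (next_S f) (next_L f)"
    by (rule next_state[OF f])
  \<comment> \<open>Lists keep the fraction 1 - 2 y with y = \<theta> r, and the term \<theta>^2
    pays for \<open>s\<close>. The target factor \<open>\<rho>\<close> for the ratio equals 1 - 12
    \<theta>^2 by the choice of \<theta>.\<close>
  define q where "q = 1 - 2 * (\<theta> * r) - \<theta>\<^sup>2"
  define \<rho> where "\<rho> = 1 - \<theta> * (1 - x) / 2"
  define z where "z = \<theta> + \<theta> * r - \<theta> / a"
  have "0 \<le> \<theta> / a" using \<theta>0 a0 by simp
  then have z: "0 \<le> z" "z \<le> 2 * \<theta>" unfolding z_def using \<theta>a \<theta>2 \<theta>r \<theta>0 by linarith+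
  have "\<sigma> = exp (- z)" by (simp add: \<sigma>_def z_def y)
  also have "\<dots> \<le> 1 - z + z\<^sup>2" by (rule exp_minus_le[OF z(1)])
  also have "z\<^sup>2 \<le> (2 * \<theta>)\<^sup>2" using z by (intro power_mono) auto
  finally have \<sigma>: "\<sigma> \<le> 1 - \<theta> - \<theta> * r + 5 * \<theta>\<^sup>2" using \<theta>a by (simp add: z_def power_mult_distrib)
  have \<theta>\<kappa>: "\<theta> * \<kappa> \<le> 3 * \<theta>\<^sup>2" using mult_left_mono[OF \<kappa>, of \<theta>] \<theta>0 by (simp add: power2_eq_square)
  have q: "1 - 3 * \<theta> \<le> q" "q \<le> 1" unfolding q_def using \<theta>r \<theta>2 \<theta>0 by linarith+
  have "1 - x = 24 * \<theta>" using \<theta>_eq by simp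
  then have "\<theta> * (1 - x) = 24 * \<theta>\<^sup>2" by (simp add: power2_eq_square)
  then have \<rho>: "\<rho> = 1 - 12 * \<theta>\<^sup>2" by (simp add: \<rho>_def)
  have "12 * \<theta>\<^sup>2 * q \<le> 12 * \<theta>\<^sup>2" using q \<theta>2 by simp
  then have "\<rho> * q \<ge> q - 12 * \<theta>\<^sup>2" by (simp add: \<rho> algebra_simps)
  moreover have "\<theta> * r \<le> \<theta> * x" using r \<theta>0 by simp
  moreover have "\<theta> - \<theta> * x = 24 * \<theta>\<^sup>2" using \<open>\<theta> * (1 - x) = 24 * \<theta>\<^sup>2\<close> by (simp add: algebra_simps)
  \<comment> \<open>The left side is at most 1 - \<theta> - \<theta> r + 10 \<theta>^2 and the right
    side at least 1 - 2 \<theta> r - 13 \<theta>^2, so 23 \<theta>^2 \<le> \<theta> (1 - r)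
    suffices. This explains the 24 in \<theta>: it gives \<theta> (1 - r) \<ge> \<theta> (1 - x) =
    24 \<theta>^2.\<close>
  ultimately have ratio: "\<sigma> + \<theta> * \<kappa> + 2 * \<theta>\<^sup>2 \<le> \<rho> * q"
    using \<sigma> \<theta>\<kappa> \<theta>2(2) q_def by linarith
  have "nibble_state P U pt E n m C (q * a) (\<rho> * r * (q * a)) (next_col f) (next_S f) (next_L f)"
  proof (rule nibble_state.weaken[OF st])
    have "q * a = a * (1 - 2 * y) - \<theta>\<^sup>2 * a" by (simp add: q_def y algebra_simps)
    then show "q * a \<le> a * (1 - 2 * y) - s" using s_le by linarith
    have "e * (\<sigma> + \<theta> * \<kappa>) + 2 * s \<le> e * (\<sigma> + \<theta> * \<kappa>) + 2 * (\<theta>\<^sup>2 * r * a)" using s_bounds by linarith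
    also have "\<dots> = e * (\<sigma> + \<theta> * \<kappa> + 2 * \<theta>\<^sup>2)" by (simp add: e algebra_simps)
    also have "\<dots> \<le> e * (\<rho> * q)" using ratio e_pos by (intro mult_left_mono) auto
    finally show "e * (\<sigma> + \<theta> * \<kappa>) + 2 * s \<le> \<rho> * r * (q * a)" by (simp add: e mult_ac)
  qed
  moreover have "(1 - 3 * \<theta>) * a \<le> q * a" "q * a \<le> a" using q a0 by (auto intro: mult_right_mono)
  ultimately show ?thesis unfolding \<rho>_def by blast
qed

text \<open>One deviation s = \<beta> n serves all \<open>T\<close> rounds: \<gamma> n bounds the
  list sizes from below and x \<rho>^T bounds the ratio \<open>r\<close> from below, so \<beta> n
  \<le> \<theta>^2 r a throughout. Hence the single condition \<open>big\<close> covers every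
  round.\<close>

lemma nibble_iterate:
  fixes x \<beta> :: real and C n :: nat
  assumes x: "0 < x" "x < 1" and \<theta>: "\<theta> = (1 - x) / 24" and \<rho>: "\<rho> = 1 - \<theta> * (1 - x) / 2"
    and \<gamma>: "\<gamma> = (1 - 3 * \<theta>) ^ T" and \<beta>: "\<beta> = \<theta>\<^sup>2 * (x * \<rho> ^ T) * \<gamma>"
    and n: "n \<ge> 1" "1 \<le> \<theta> * (\<gamma> * n)"
    and big: "4 * (5 * real n ^ 2 * exp (- (\<beta> * n)\<^sup>2 / (4 * real C * real n))) * (real n ^ 2 + 1) ^ 4 \<le> 1"
    and start: "nibble_state P U pt E n m C (real n) (x * n) g0 S0 L0"
    and t: "t \<le> T"
  shows "\<exists>a g S L. nibble_state P U pt E n m C a (x * \<rho> ^ t * a) g S L \<and> (1 - 3 * \<theta>) ^ t * n \<le> a \<and> a \<le> n"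
  using t
proof (induction t)
  case 0
  show ?case using start by (intro exI[of _ "real n"] exI[of _ g0] exI[of _ S0] exI[of _ L0]) simp
next
  case (Suc t)
  then obtain a g S L where st: "nibble_state P U pt E n m C a (x * \<rho> ^ t * a) g S L"
    and a: "(1 - 3 * \<theta>) ^ t * n \<le> a" "a \<le> n" by auto
  have \<theta>0: "0 < \<theta>" "\<theta> \<le> 1/24" using x \<theta> by auto
  have "\<theta> * (1 - x) \<le> 1 * 1" using x \<theta>0 by (intro mult_mono) auto
  moreover have "\<theta> * (1 - x) \<ge> 0" using x \<theta>0 by simp
  ultimately have \<rho>01: "0 < \<rho>" "\<rho> \<le> 1" unfolding \<rho> by auto
  have "\<gamma> \<le> (1 - 3 * \<theta>) ^ t" unfolding \<gamma> using \<theta>0 Suc by (intro power_decreasing) auto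
  then have "\<gamma> * n \<le> (1 - 3 * \<theta>) ^ t * n" by (intro mult_right_mono) auto
  then have \<gamma>a: "\<gamma> * n \<le> a" using a by linarith
  have \<gamma>0: "\<gamma> > 0" unfolding \<gamma> using \<theta>0 by simp
  have \<rho>t: "\<rho> ^ T \<le> \<rho> ^ t" "\<rho> ^ t \<le> 1" "\<rho> ^ t > 0" "\<rho> ^ T > 0"
    using \<rho>01 Suc by (auto intro: power_decreasing power_le_one)
  have "\<exists>a' g' S' L'. nibble_state P U pt E n m C a' ((1 - \<theta> * (1 - x) / 2) * (x * \<rho> ^ t) * a') g' S' L' \<and>
      (1 - 3 * \<theta>) * a \<le> a' \<and> a' \<le> a"
  proof (rule nibble_state.nibble_round[OF st x \<theta> _ _ refl _ a(2) _ _ big])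
    show "0 < x * \<rho> ^ t" using x \<rho>t by simp
    show "x * \<rho> ^ t \<le> x" using x \<rho>t by (simp add: mult_left_le)
    show "1 \<le> \<theta> * a" using n(2) mult_left_mono[OF \<gamma>a, of \<theta>] \<theta>0 by linarith
    show "0 < \<beta> * n" unfolding \<beta> using \<theta>0 x \<rho>t \<gamma>0 n by simp
    have "\<theta>\<^sup>2 * (x * \<rho> ^ T) * (\<gamma> * n) \<le> \<theta>\<^sup>2 * (x * \<rho> ^ t) * a"
      using \<gamma>a \<rho>t x \<gamma>0 by (intro mult_mono mult_left_mono mult_nonneg_nonneg) auto
    then show "\<beta> * n \<le> \<theta>\<^sup>2 * (x * \<rho> ^ t) * a" unfolding \<beta> by (simp add: mult_ac)
  qed
  then obtain a' g' S' L' where st': "nibble_state P U pt E n m C a' (\<rho> * (x * \<rho> ^ t) * a') g' S' L'"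
    and a': "(1 - 3 * \<theta>) * a \<le> a'" "a' \<le> a" unfolding \<rho> by blast
  have "(1 - 3 * \<theta>) * ((1 - 3 * \<theta>) ^ t * n) \<le> (1 - 3 * \<theta>) * a"
    using a \<theta>0 by (intro mult_left_mono) auto
  then have "(1 - 3 * \<theta>) ^ Suc t * n \<le> a'" "a' \<le> n" using a' a by (auto simp: mult_ac)
  moreover have "\<rho> * (x * \<rho> ^ t) * a' = x * \<rho> ^ Suc t * a'" by simp
  ultimately show ?case using st' by metis
qed

text \<open>The number \<open>T\<close> of rounds depends on \<open>x\<close> alone, and so does
  \<beta>. The deviation is thus linear in \<open>n\<close>, and the failure probability exp (- k n)
  beats the polynomial number of dependencies.\<close>

lemma exists_full_colouring:
  fixes x :: real and C :: nat
  assumes x: "0 < x" "x < 1" and C: "C \<ge> 1"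
  shows "\<exists>n0. \<forall>n\<ge>n0. \<forall>P U pt (E :: 'a \<Rightarrow> 'a \<Rightarrow> bool) m. part_graph P U pt E n m C \<longrightarrow>
     (\<forall>i\<in>P. card {v \<in> U. pt v = i} = n) \<longrightarrow> real m \<le> x * n \<longrightarrow> (\<forall>v. real (card {u. E v u}) \<le> x * n) \<longrightarrow>
     (\<exists>h. full_colouring P U pt E m h)"
proof -
  define \<theta> where "\<theta> = (1 - x) / 24"
  define \<rho> where "\<rho> = 1 - \<theta> * (1 - x) / 2"
  have \<theta>0: "0 < \<theta>" "\<theta> \<le> 1/24" using x \<theta>_def by auto
  have "\<theta> * (1 - x) \<le> 1 * 1" using x \<theta>0 by (intro mult_mono) auto
  moreover have "\<theta> * (1 - x) > 0" using x \<theta>0 by simp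
  ultimately have \<rho>01: "0 < \<rho>" "\<rho> < 1" unfolding \<rho>_def by auto
  \<comment> \<open>1/32 is the ratio e / a at which \<open>finish\<close> takes over.\<close>
  obtain T where T: "\<rho> ^ T < 1 / 32" using real_arch_pow_inv[of "1/32" \<rho>] \<rho>01 by auto
  define \<gamma> where "\<gamma> = (1 - 3 * \<theta>) ^ T"
  define \<beta> where "\<beta> = \<theta>\<^sup>2 * (x * \<rho> ^ T) * \<gamma>"
  have \<gamma>0: "\<gamma> > 0" unfolding \<gamma>_def using \<theta>0 by simp
  have \<beta>0: "\<beta> > 0" unfolding \<beta>_def using \<gamma>0 \<theta>0 x \<rho>01 by simp
  define k where "k = \<beta>\<^sup>2 / (4 * real C)"
  have k0: "k > 0" unfolding k_def using \<beta>0 C by simp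
  have "(\<lambda>n::nat. 4 * (5 * real n ^ 2 * exp (- k * real n)) * (real n ^ 2 + 1) ^ 4) \<longlonglongrightarrow> 0"
    using k0 by real_asymp
  then have "\<forall>\<^sub>F n::nat in sequentially. 4 * (5 * real n ^ 2 * exp (- k * real n)) * (real n ^ 2 + 1) ^ 4 < 1"
    by (rule order_tendstoD) simp
  then obtain n1 where n1: "\<And>n::nat. n \<ge> n1 \<Longrightarrow> 4 * (5 * real n ^ 2 * exp (- k * real n)) * (real n ^ 2 + 1) ^ 4 < 1"
    by (auto simp: eventually_sequentially)
  define n0 where "n0 = max (max 1 n1) (nat \<lceil>1 / (\<theta> * \<gamma>)\<rceil>)"
  show ?thesis
  proof (intro exI[of _ n0] allI impI)
    fix n :: nat and P U pt and E :: "'a \<Rightarrow> 'a \<Rightarrow> bool" and m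
    assume n: "n \<ge> n0" and pg: "part_graph P U pt E n m C" and full: "\<forall>i\<in>P. card {v \<in> U. pt v = i} = n"
      and m: "real m \<le> x * n" and deg: "\<forall>v. real (card {u. E v u}) \<le> x * n"
    have n': "n \<ge> 1" "n \<ge> n1" "real n \<ge> 1 / (\<theta> * \<gamma>)" using n by (auto simp: n0_def nat_le_iff ceiling_le_iff)
    interpret part_graph P U pt E n m C by (rule pg)
    \<comment> \<open>Nothing is coloured and the lists are the whole parts, so a vertex is in the
      lists of all \<open>m\<close> colours and sees all its neighbours; both numbers are at most x
      n.\<close>
    have start: "nibble_state P U pt E n m C (real n) (x * n) (\<lambda>_ _. None) U (\<lambda>i c. {v \<in> U. pt v = i})"
    proof unfold_locales
      show "real n \<le> real (card {v \<in> U. pt v = i})" if "i \<in> P" for i using full that by simp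
      show "real (card {c. c < m \<and> (None :: 'a option) = None \<and> v \<in> {u \<in> U. pt u = pt v}}) \<le> x * n" if "v \<in> U" for v
        using m that by simp
      show "real (card {u \<in> U. E v u \<and> (None :: 'a option) = None}) \<le> x * n" for v
      proof -
        have "{u \<in> U. E v u \<and> (None :: 'a option) = None} = {u. E v u}" using E_U2 by auto
        then show ?thesis using deg by simp
      qed
    qed auto
    have "1 \<le> \<theta> * (\<gamma> * n)" using n'(3) \<theta>0 \<gamma>0 by (simp add: field_simps)
    moreover have "4 * (5 * real n ^ 2 * exp (- (\<beta> * n)\<^sup>2 / (4 * real C * real n))) * (real n ^ 2 + 1) ^ 4 \<le> 1"
    proof -
      have "- (\<beta> * n)\<^sup>2 / (4 * real C * real n) = - k * real n"
        using n' C by (simp add: k_def power2_eq_square field_simps)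
      then show ?thesis using n1[OF n'(2)] by simp
    qed
    ultimately obtain a g S L where st: "nibble_state P U pt E n m C a (x * \<rho> ^ T * a) g S L" and a: "\<gamma> * n \<le> a"
      using nibble_iterate[OF x \<theta>_def \<rho>_def \<gamma>_def \<beta>_def n'(1) _ _ start order_refl] unfolding \<gamma>_def by blast
    have a0: "a > 0" using a \<gamma>0 n' by (smt (verit) mult_pos_pos of_nat_0_less_iff zero_less_one le_less_trans of_nat_1 of_nat_mono)
    have "x * \<rho> ^ T \<le> 1 * (1 / 32)" using x T \<rho>01 by (intro mult_mono) auto
    then have "x * \<rho> ^ T * a \<le> 1 / 32 * a" using a0 by (intro mult_right_mono) auto
    then have "32 * (x * \<rho> ^ T * a) \<le> a" by simp
    then show "\<exists>h. full_colouring P U pt E m h"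
      using nibble_state.finish[OF st a0] x \<rho>01 a0 by auto
  qed
qed

section \<open>Reduction to parts of equal size and passage to transversals\<close>

theorem theorem1p7:
  fixes \<epsilon> C :: real
  assumes "0 < \<epsilon>" and "\<epsilon> < 1" and "C > 0"
  shows "\<exists>n0::nat. \<forall>n\<ge>n0. \<forall>(k::nat) (V :: nat \<Rightarrow> 'a set) (E :: 'a \<Rightarrow> 'a \<Rightarrow> bool).
           k \<ge> 1 \<longrightarrow>
           multipartite_graph k V E \<longrightarrow>
           (\<forall>i\<in>{1..k}. card (V i) \<ge> n) \<longrightarrow>
           real (max_degree k V E) \<le> (1 - \<epsilon>) * real n \<longrightarrow>
           real (local_degree k V E) \<le> C \<longrightarrow>
           (\<exists>\<T> :: 'a set set. finite \<T> \<and> disjoint \<T> \<and>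
              (\<forall>T\<in>\<T>. independent_transversal k V E T) \<and>
              real (card \<T>) \<ge> (1 - \<epsilon>) * real n)"
proof -
  \<comment> \<open>Half of the slack \<epsilon> is spent on rounding up: n \<ge> 2 / \<epsilon>
    gives m < (1 - \<epsilon>) n + 1 \<le> x n.\<close>
  define x where "x = 1 - \<epsilon> / 2"
  define D where "D = nat \<lceil>C\<rceil>"
  have x: "0 < x" "x < 1" using assms by (auto simp: x_def)
  have D: "D \<ge> 1" using assms(3) unfolding D_def by linarith
  obtain n1 where n1: "\<forall>n\<ge>n1. \<forall>P U pt (E :: 'a \<Rightarrow> 'a \<Rightarrow> bool) m. part_graph P U pt E n m D \<longrightarrow>
     (\<forall>i\<in>P. card {v \<in> U. pt v = i} = n) \<longrightarrow> real m \<le> x * n \<longrightarrow> (\<forall>v. real (card {u. E v u}) \<le> x * n) \<longrightarrow>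
     (\<exists>h. full_colouring P U pt E m h)"
    using exists_full_colouring[OF x D] by (rule exE)
  define n0 where "n0 = max (max 1 n1) (nat \<lceil>2 / \<epsilon>\<rceil>)"
  show ?thesis
  proof (intro exI[of _ n0] allI impI)
    fix n k :: nat and V :: "nat \<Rightarrow> 'a set" and E :: "'a \<Rightarrow> 'a \<Rightarrow> bool"
    assume n: "n \<ge> n0" and k: "k \<ge> 1" and mp: "multipartite_graph k V E"
      and size: "\<forall>i\<in>{1..k}. card (V i) \<ge> n"
      and maxd: "real (max_degree k V E) \<le> (1 - \<epsilon>) * real n"
      and locd: "real (local_degree k V E) \<le> C"
    have n': "n \<ge> 1" "n \<ge> n1" "real n \<ge> 2 / \<epsilon>" using n by (auto simp: n0_def nat_le_iff ceiling_le_iff)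
    define m where "m = nat \<lceil>(1 - \<epsilon>) * n\<rceil>"
    have m1: "(1 - \<epsilon>) * n \<le> real m" by (simp add: m_def real_nat_ceiling_ge)
    have "(1 - \<epsilon>) * n \<ge> 0" using assms by simp
    then have "real m < (1 - \<epsilon>) * n + 1" unfolding m_def by linarith
    moreover have "\<epsilon> * n \<ge> 2" using n'(3) assms by (simp add: field_simps)
    ultimately have mx: "real m \<le> x * n" by (simp add: x_def algebra_simps)
    have "x * n \<le> 1 * real n" using x by (intro mult_right_mono) auto
    then have mn: "m \<le> n" using mx by simp
    let ?V = "part_union k V"
    have finV: "finite ?V" using mp by (auto simp: multipartite_graph_def part_union_def)
    have disj: "disjoint_family_on V {1..k}" and EV: "\<And>u v. E u v \<Longrightarrow> u \<in> ?V \<and> v \<in> ?V"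
      and sym: "\<And>u v. E u v \<Longrightarrow> E v u" and noE: "\<And>i u v. i \<in> {1..k} \<Longrightarrow> u \<in> V i \<Longrightarrow> v \<in> V i \<Longrightarrow> \<not> E u v"
      using mp unfolding multipartite_graph_def by blast+
    \<comment> \<open>\<open>part_graph\<close> bounds the degree of every element of the type,
      whereas \<open>max_degree\<close> speaks of vertices only; other elements have no
      neighbours.\<close>
    have degV: "real (card {u. E v u}) \<le> (1 - \<epsilon>) * n" for v
    proof (cases "v \<in> ?V")
      case True
      then have "card (neighbours E v) \<le> max_degree k V E"
        unfolding max_degree_def using finV by (intro Max_ge) auto
      then show ?thesis using maxd by (simp add: neighbours_def)
    next
      case False
      then have "{u. E v u} = {}" using EV by auto
      then show ?thesis using assms by simp
    qed
    have locV: "card (neighbours E v \<inter> V i) \<le> D" if "i \<in> {1..k}" for v i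
    proof (cases "v \<in> ?V")
      case True
      have "finite ((\<lambda>(v, i). card (neighbours E v \<inter> V i)) ` (?V \<times> {1..k}))" using finV by auto
      then have "card (neighbours E v \<inter> V i) \<le> local_degree k V E"
        unfolding local_degree_def using True that by (intro Max_ge) auto
      then show ?thesis using locd unfolding D_def by linarith
    next
      case False
      then have "neighbours E v = {}" using EV by (auto simp: neighbours_def)
      then show ?thesis by simp
    qed
    \<comment> \<open>Each part is cut down to exactly \<open>n\<close> vertices; a transversal of
      the smaller parts is one of the original parts.\<close>
    define W where "W i = (SOME M. M \<subseteq> V i \<and> card M = n)" for i
    have W: "W i \<subseteq> V i \<and> card (W i) = n" if "i \<in> {1..k}" for i
    proof -
      have "n \<le> card (V i)" using size that by blast
      then obtain M where "M \<subseteq> V i" "card M = n" by (rule obtain_subset_with_card_n)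
      then have "\<exists>M. M \<subseteq> V i \<and> card M = n" by blast
      then show ?thesis unfolding W_def by (rule someI_ex)
    qed
    define U where "U = (\<Union>i\<in>{1..k}. W i)"
    define pt where "pt v = (THE i. i \<in> {1..k} \<and> v \<in> V i)" for v
    have pt: "pt v = i" if "i \<in> {1..k}" "v \<in> V i" for v i
      unfolding pt_def
    proof (rule the_equality)
      fix j assume j: "j \<in> {1..k} \<and> v \<in> V j"
      show "j = i"
      proof (rule ccontr)
        assume "j \<noteq> i"
        then have "V j \<inter> V i = {}" using disj j that(1) by (auto simp: disjoint_family_on_def)
        then show False using j that(2) by auto
      qed
    qed (use that in auto)
    have UV: "U \<subseteq> ?V" unfolding U_def part_union_def by (rule UN_mono) (use W in blast)+
    have ptU: "pt v \<in> {1..k} \<and> v \<in> V (pt v)" if "v \<in> ?V" for v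
    proof -
      obtain i where "i \<in> {1..k}" "v \<in> V i" using \<open>v \<in> ?V\<close> by (auto simp: part_union_def)
      then show ?thesis using pt by simp
    qed
    have Ui: "{v \<in> U. pt v = i} = W i" if "i \<in> {1..k}" for i
    proof
      show "{v \<in> U. pt v = i} \<subseteq> W i"
      proof
        fix v assume v: "v \<in> {v \<in> U. pt v = i}"
        then obtain j where j: "j \<in> {1..k}" "v \<in> W j" by (auto simp: U_def)
        then have "pt v = j" using W[OF j(1)] by (intro pt) auto
        then show "v \<in> W i" using j v by simp
      qed
      show "W i \<subseteq> {v \<in> U. pt v = i}"
        using W[OF that] pt[OF that] that unfolding U_def by blast
    qed
    \<comment> \<open>The subgraph induced on \<open>U\<close>, since \<open>part_graph\<close>
      requires edges to stay inside its vertex set. On \<open>U\<close> it agrees with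
      \<open>E\<close>, so independence carries back.\<close>
    define F where "F u v \<longleftrightarrow> E u v \<and> u \<in> U \<and> v \<in> U" for u v
    have finU: "finite U" using UV finV finite_subset by blast
    have degF: "card {u. F v u} \<le> card {u. E v u}" for v
      by (rule card_mono) (use EV finV finite_subset[of "{u. E v u}" ?V] in \<open>auto simp: F_def\<close>)
    have pg: "part_graph {1..k} U pt F n m D"
    proof
      show "finite {1..k}" "finite U" "1 \<le> D" "m \<le> n" "1 \<le> n" using finU D mn n' by auto
      show "pt u \<in> {1..k}" if "u \<in> U" for u using ptU that UV by blast
      show "F v u" if "F u v" for u v using that sym by (auto simp: F_def)
      show "u \<in> U" if "F u v" for u v using that by (auto simp: F_def)
      show "pt u \<noteq> pt v" if "F u v" for u v
      proof
        assume eq: "pt u = pt v"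
        have "E u v" "u \<in> ?V" "v \<in> ?V" using that UV by (auto simp: F_def)
        then show False using noE[of "pt v" u v] ptU[of u] ptU[of v] eq by simp
      qed
      show "card {v \<in> U. pt v = i} \<le> n" for i
      proof (cases "i \<in> {1..k}")
        case True then show ?thesis using Ui W by simp
      next
        case False
        then have "{v \<in> U. pt v = i} = {}" using ptU UV by blast
        then show ?thesis by (metis card.empty zero_le)
      qed
      show "card {u. F v u} \<le> n" for v
      proof -
        have "(1 - \<epsilon>) * n \<le> 1 * real n" using assms by (intro mult_right_mono) auto
        then show ?thesis using degF[of v] degV[of v] by linarith
      qed
      show "card {u. F v u \<and> pt u = i} \<le> D" for v i
      proof (cases "i \<in> {1..k}")
        case True
        have "{u. F v u \<and> pt u = i} \<subseteq> neighbours E v \<inter> V i"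
          using ptU UV unfolding F_def neighbours_def by blast
        then have "card {u. F v u \<and> pt u = i} \<le> card (neighbours E v \<inter> V i)"
          using mp True by (intro card_mono) (auto simp: multipartite_graph_def)
        then show ?thesis using locV[OF True, of v] by linarith
      next
        case False
        then have "{u. F v u \<and> pt u = i} = {}" using ptU UV unfolding F_def by blast
        then show ?thesis by (metis card.empty zero_le)
      qed
    qed
    have "\<exists>h. full_colouring {1..k} U pt F m h"
    proof (rule n1[rule_format, OF n'(2) pg _ mx])
      show "card {v \<in> U. pt v = i} = n" if "i \<in> {1..k}" for i using Ui[OF that] W[OF that] by simp
      have "(1 - \<epsilon>) * n \<le> x * n" using assms by (intro mult_right_mono) (auto simp: x_def)
      then show "real (card {u. F v u}) \<le> x * n" for v using degF[of v] degV[of v] by linarith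
    qed
    then obtain h where h: "full_colouring {1..k} U pt F m h" by blast
    have hU: "h i c \<in> U" "pt (h i c) = i" "h i c \<in> V i" if "i \<in> {1..k}" "c < m" for i c
    proof -
      show *: "h i c \<in> U" "pt (h i c) = i" using h that unfolding full_colouring_def by blast+
      show "h i c \<in> V i" using ptU[OF subsetD[OF UV *(1)]] *(2) by simp
    qed
    define tr where "tr c = (\<lambda>i. h i c) ` {1..k}" for c
    \<comment> \<open>A common vertex determines its part \<open>i\<close>, and injectivity of
      \<open>h i\<close> then determines the colour.\<close>
    have tr_eq: "c = d" if cd: "c < m" "d < m" "z \<in> tr c" "z \<in> tr d" for c d z
    proof -
      obtain i j where ij: "i \<in> {1..k}" "z = h i c" "j \<in> {1..k}" "z = h j d" using cd(3,4) unfolding tr_def by blast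
      then have "i = j" using hU(2)[OF ij(1) that(1)] hU(2)[OF ij(3) that(2)] by simp
      then have "h i c = h i d" using ij by simp
      moreover have "inj_on (h i) {..<m}" using h ij(1) by (auto simp: full_colouring_def)
      ultimately show ?thesis using that by (auto simp: inj_on_def)
    qed
    \<comment> \<open>As k \<ge> 1, the transversals are nonempty; being disjoint, they are distinct
      for distinct colours, so there are exactly \<open>m\<close> of them.\<close>
    have ne: "h 1 c \<in> tr c" for c using k by (auto simp: tr_def)
    show "\<exists>\<T> :: 'a set set. finite \<T> \<and> disjoint \<T> \<and>
              (\<forall>T\<in>\<T>. independent_transversal k V E T) \<and>
              real (card \<T>) \<ge> (1 - \<epsilon>) * real n"
    proof (intro exI[of _ "tr ` {..<m}"] conjI ballI)
      show "finite (tr ` {..<m})" by simp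
      show "disjoint (tr ` {..<m})"
        by (rule disjointI) (use tr_eq in blast)
      have "inj_on tr {..<m}" using tr_eq ne by (intro inj_onI) (metis lessThan_iff)
      then show "(1 - \<epsilon>) * real n \<le> real (card (tr ` {..<m}))" using m1 by (simp add: card_image)
      fix T assume "T \<in> tr ` {..<m}"
      then obtain c where c: "c < m" "T = tr c" by auto
      have "card (T \<inter> V i) = 1" if i: "i \<in> {1..k}" for i
      proof -
        have "T \<inter> V i = {h i c}"
        proof
          show "T \<inter> V i \<subseteq> {h i c}"
          proof
            fix z assume z: "z \<in> T \<inter> V i"
            then obtain j where j: "j \<in> {1..k}" "z = h j c" unfolding c tr_def by blast
            then have "j = i" using pt[OF i, of z] hU(2)[OF j(1) c(1)] z by simp
            then show "z \<in> {h i c}" using j by simp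
          qed
          show "{h i c} \<subseteq> T \<inter> V i" using hU(3)[OF i c(1)] i by (auto simp: c tr_def)
        qed
        then show ?thesis by simp
      qed
      moreover have "T \<subseteq> ?V" using hU(1)[OF _ c(1)] UV by (auto simp: c tr_def)
      moreover have "\<not> E u v" if uv: "u \<in> T" "v \<in> T" for u v
      proof -
        obtain i j where ij: "i \<in> {1..k}" "u = h i c" "j \<in> {1..k}" "v = h j c" using uv unfolding c tr_def by blast
        then have "\<not> F u v" using h c(1) unfolding full_colouring_def by blast
        then show ?thesis using hU(1)[OF ij(1) c(1)] hU(1)[OF ij(3) c(1)] ij by (simp add: F_def)
      qed
      ultimately show "independent_transversal k V E T"
        unfolding independent_transversal_def independent_set_def by blast
    qed
  qed
qed

end
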